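(* Let $q>1$ and suppose that the probability density function $\psi(\cdot)$ of $z(T)$ is a continuous function. Let $p=\frac{1}{q-1}$ and consider the problem $$(\mathcal{A}^q)\quad \min_{X\in L^2_{\mathcal F_T}(\Omega;\mathbb R)} \mathrm{E}\big[(\gamma-X)_+^q\big]\quad\text{subject to}\quad \mathrm{E}[X]\ge d,\ \ \mathrm{E}[z(T)X]=x_0,\ \ 0\le X\le B .$$ For $\eta>0$, $\lambda\ge0$ put $$X_{\lambda,\eta}:=B\mathbf 1_{\eta z(T)\le\lambda}+\Big(\gamma-\Big(\frac{\eta z(T)-\lambda}{q}\Big)^{\frac1{q-1}}\Big)\mathbf 1_{\lambda<\eta z(T)\le\lambda+q\gamma^{q-1}} .$$ Then the following hold. (i) If $\underline d<d<\bar d$, the solution of $(\mathcal A^q)$ is given by $X_{\lambda,\eta}$, and there is a unique pair $\lambda>0$, $\eta>0$ satisfying $\mathrm E[X_{\lambda,\eta}]=d$ and $\mathrm E[z(T)X_{\lambda,\eta}]=x_0$. (ii) If $d\le\underline d$ and $x_0<\gamma\,\mathrm E[z(T)]$, the solution of $(\mathcal A^q)$ is given by $X_{\lambda,\eta}$ with $\lambda=0$ and $\eta=q\gamma^{q-1}/K_{p}^{-1}(x_0/\gamma)$, and this pair satisfies $\mathrm E[X_{\lambda,\eta}]\ge d$ and $\mathrm E[z(T)X_{\lambda,\eta}]=x_0$. (iii) If $d\le\underline d$ and $x_0\ge\gamma\,\mathrm E[z(T)]$, then $(\mathcal A^q)$ has multiple solutions, which are characterized by the set $$\mathcal X:=\{Y\in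 L^2_{\mathcal F_T}(\Omega;\mathbb R)\mid \gamma\le Y\le B,\ \mathrm E[Y]\ge d,\ \mathrm E[z(T)Y]=x_0\},$$ and one of such solutions is $$x^*(T)=(B-\gamma)\mathbf 1_{z(T)\le H_1^{-1}\left(\frac{x_0-\gamma \mathrm E[z(T)]}{B-\gamma}\right)}+\gamma .$$
   Context: $(\Omega,\mathcal F,\mathbb P,\{\mathcal F_t\})$ is a complete filtered probability space carrying an $n$-dimensional Brownian motion $W$. The market has a risk-free asset with adapted rate $r(t)$ and $n$ risky assets with adapted, uniformly bounded drifts $\mu_i(t)$ and volatilities $\sigma_{ij}(t)$, the matrix $\sigma(t)=(\sigma_{ij}(t))$ satisfying $\sigma(t)\sigma(t)'\succ\epsilon I$ for all $t\in[0,T]$ and some $\epsilon>0$; $b(t)=(\mu_1(t)-r(t),\dots,\mu_n(t)-r(t))'$, $\theta(t)=\sigma(t)^{-1}b(t)$, and the state price density is $$z(t)=\exp\Big\{-\int_0^t\big(r(s)+\tfrac12\|\theta(s)\|^2\big)ds-\int_0^t\theta(s)'dW(s)\Big\}.$$ $L^2_{\mathcal F_T}(\Omega;\mathbb R)$ is the set of square integrable $\mathcal F_T$-measurable real random variables; $(a)_+=a\mathbf 1_{a\ge0}$ and $(a)_+^q=((a)_+)^q$. Parameters: initial wealth $x_0$, target $d$, a given benchmark level $\gamma\in\mathbb R$, $q$ a given nonnegative integer, and upper bound $B>\max\{d,\bar x_T,\gamma\}$, where $\bar x_T$ is a given safe level of terminal wealth (e.g. $\bar x_T=\mathrm E[e^{\int_0^Tr(s)ds}]x_0$).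 For $y>0$ and $p\ge 0$ define $$H_p(y)=\mathrm E[z(T)^p\mathbf 1_{z(T)\le y}],\quad K_p(y)=H_1(y)-H_{p+1}(y)/y^p,\quad J_p(y)=H_0(y)-H_p(y)/y^p ,$$ and let $H_1^{-1}$, $K_p^{-1}$ denote the inverse functions of $H_1$, $K_p$. For $q>1$, with $p=1/(q-1)$, $$\underline d=\begin{cases}\gamma J_p\big(K_p^{-1}(x_0/\gamma)\big), & x_0<\gamma\mathrm E[z(T)],\\ (B-\gamma)H_0\Big(H_1^{-1}\Big(\frac{x_0-\gamma\mathrm E[z(T)]}{B-\gamma}\Big)\Big)+\gamma,& x_0\ge\gamma\mathrm E[z(T)],\end{cases}\qquad \bar d=B\,H_0\big(H_1^{-1}(x_0/B)\big).$$
   Formalization: Assumes γ ≥ 0 (for γ < 0, x*(T) takes the negative value γ, so (iii) fails) and 0 < x_0 < B E[z(T)]; in (iii), two distinct solutions are claimed only if d < d_lower and x_0 > γE[z(T)], since at either equality the solution is a.s. unique. *)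

theory Defs
  imports "HOL-Probability.Probability"
begin

text \<open>
  Time runs over the real numbers, only the horizon \<open>{0..T}\<close> matters.  A filtration is a family
  \<open>F\<close> of measure spaces of which only the sigma-algebras are used; probabilities are always those
  of \<open>M\<close>.
\<close>

definition progressive ::
  "(real \<Rightarrow> 'a measure) \<Rightarrow> real \<Rightarrow> (real \<Rightarrow> 'a \<Rightarrow> 'b::topological_space) \<Rightarrow> bool" where
  "progressive F T X \<longleftrightarrow>
     (\<forall>t\<in>{0..T}. (\<lambda>(s, \<omega>). X s \<omega>) \<in> borel_measurable (restrict_space borel {0..t} \<Otimes>\<^sub>M F t))"

definition brownian_motion ::
  "'a measure \<Rightarrow> (real \<Rightarrow> 'a measure) \<Rightarrow> real \<Rightarrow> (real \<Rightarrow> 'a \<Rightarrow> real ^ 'n) \<Rightarrow> bool" where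
  "brownian_motion M F T W \<longleftrightarrow>
     (\<forall>t\<in>{0..T}. W t \<in> borel_measurable (F t)) \<and>
     (AE \<omega> in M. W 0 \<omega> = 0) \<and>
     (AE \<omega> in M. continuous_on {0..T} (\<lambda>t. W t \<omega>)) \<and>
     (\<forall>s t. 0 \<le> s \<and> s < t \<and> t \<le> T \<longrightarrow>
        prob_space.indep_set M (sets (F s))
          {(\<lambda>\<omega>. W t \<omega> - W s \<omega>) -` A \<inter> space M | A. A \<in> sets borel} \<and>
        prob_space.indep_vars M (\<lambda>_. borel) (\<lambda>i \<omega>. (W t \<omega> - W s \<omega>) $ i) UNIV \<and>
        (\<forall>i. distributed M lborel (\<lambda>\<omega>. (W t \<omega> - W s \<omega>) $ i) (normal_density 0 (sqrt (t - s)))))"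

text \<open>
  The Ito integral over \<open>{0..T}\<close> of a progressive integrand with almost surely square integrable
  paths, by approximation in probability with elementary integrands
  \<open>\<Sum>k<N. \<xi> k * 1 (\<tau> k, \<tau> (k + 1)]\<close>.
\<close>

definition elementary_integrand ::
  "(real \<Rightarrow> 'a measure) \<Rightarrow> real \<Rightarrow> nat \<Rightarrow> (nat \<Rightarrow> real) \<Rightarrow> (nat \<Rightarrow> 'a \<Rightarrow> real ^ 'n) \<Rightarrow> bool" where
  "elementary_integrand F T N \<tau> \<xi> \<longleftrightarrow>
     (\<forall>k\<le>N. \<tau> k \<in> {0..T}) \<and> (\<forall>k<N. \<tau> k \<le> \<tau> (Suc k)) \<and>
     (\<forall>k<N. \<xi> k \<in> borel_measurable (F (\<tau> k)) \<and> bounded (\<xi> k ` space (F (\<tau> k))))"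

definition elementary_process ::
  "nat \<Rightarrow> (nat \<Rightarrow> real) \<Rightarrow> (nat \<Rightarrow> 'a \<Rightarrow> real ^ 'n) \<Rightarrow> real \<Rightarrow> 'a \<Rightarrow> real ^ 'n" where
  "elementary_process N \<tau> \<xi> t \<omega> = (\<Sum>k<N. indicat_real {\<tau> k<..\<tau> (Suc k)} t *\<^sub>R \<xi> k \<omega>)"

definition elementary_integral ::
  "(real \<Rightarrow> 'a \<Rightarrow> real ^ 'n) \<Rightarrow> nat \<Rightarrow> (nat \<Rightarrow> real) \<Rightarrow> (nat \<Rightarrow> 'a \<Rightarrow> real ^ 'n) \<Rightarrow> 'a \<Rightarrow> real" where
  "elementary_integral W N \<tau> \<xi> \<omega> = (\<Sum>k<N. \<xi> k \<omega> \<bullet> (W (\<tau> (Suc k)) \<omega> - W (\<tau> k) \<omega>))"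

definition tendsto_in_prob :: "'a measure \<Rightarrow> (nat \<Rightarrow> 'a \<Rightarrow> real) \<Rightarrow> ('a \<Rightarrow> real) \<Rightarrow> bool" where
  "tendsto_in_prob M X Y \<longleftrightarrow>
     (\<forall>e>0. (\<lambda>m. measure M {\<omega> \<in> space M. e < \<bar>X m \<omega> - Y \<omega>\<bar>}) \<longlonglongrightarrow> 0)"

definition is_ito_integral ::
  "'a measure \<Rightarrow> (real \<Rightarrow> 'a measure) \<Rightarrow> (real \<Rightarrow> 'a \<Rightarrow> real ^ 'n) \<Rightarrow> real \<Rightarrow>
     (real \<Rightarrow> 'a \<Rightarrow> real ^ 'n) \<Rightarrow> ('a \<Rightarrow> real) \<Rightarrow> bool" where
  "is_ito_integral M F W T \<theta> I \<longleftrightarrow>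
     progressive F T \<theta> \<and>
     (AE \<omega> in M. set_integrable lborel {0..T} (\<lambda>t. (norm (\<theta> t \<omega>))\<^sup>2)) \<and>
     I \<in> borel_measurable (F T) \<and>
     (\<exists>N \<tau> \<xi>. (\<forall>m. elementary_integrand F T (N m) (\<tau> m) (\<xi> m)) \<and>
        tendsto_in_prob M
          (\<lambda>m \<omega>. LINT t:{0..T}|lborel. (norm (elementary_process (N m) (\<tau> m) (\<xi> m) t \<omega> - \<theta> t \<omega>))\<^sup>2)
          (\<lambda>_. 0) \<and>
        tendsto_in_prob M (\<lambda>m. elementary_integral W (N m) (\<tau> m) (\<xi> m)) I)"

definition excess_return ::
  "(real \<Rightarrow> 'a \<Rightarrow> real) \<Rightarrow> ('n \<Rightarrow> real \<Rightarrow> 'a \<Rightarrow> real) \<Rightarrow> real \<Rightarrow> 'a \<Rightarrow> real ^ 'n::finite" where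
  "excess_return r \<mu> t \<omega> = (\<chi> i. \<mu> i t \<omega> - r t \<omega>)"

definition market_price_of_risk ::
  "(real \<Rightarrow> 'a \<Rightarrow> real) \<Rightarrow> ('n \<Rightarrow> real \<Rightarrow> 'a \<Rightarrow> real) \<Rightarrow> (real \<Rightarrow> 'a \<Rightarrow> real ^ 'n ^ 'n) \<Rightarrow>
     real \<Rightarrow> 'a \<Rightarrow> real ^ 'n::finite" where
  "market_price_of_risk r \<mu> \<sigma> t \<omega> = matrix_inv (\<sigma> t \<omega>) *v excess_return r \<mu> t \<omega>"

locale market = prob_space M + complete_measure M + filtration "space M" F
  for M :: "'a measure" and F :: "real \<Rightarrow> 'a measure" +
  fixes T :: real
    and W :: "real \<Rightarrow> 'a \<Rightarrow> real ^ 'n::finite"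
    and r :: "real \<Rightarrow> 'a \<Rightarrow> real"
    and \<mu> :: "'n \<Rightarrow> real \<Rightarrow> 'a \<Rightarrow> real"
    and \<sigma> :: "real \<Rightarrow> 'a \<Rightarrow> real ^ 'n ^ 'n"
  assumes horizon: "0 < T"
    and sets_F_le: "sets (F t) \<subseteq> sets M"
    and null_sets_F: "null_sets M \<subseteq> sets (F 0)"
    and brownian: "brownian_motion M F T W"
    and rate: "progressive F T r" "AE \<omega> in M. set_integrable lborel {0..T} (\<lambda>t. r t \<omega>)"
    and drift: "progressive F T (\<mu> i)"
      "\<exists>C. \<forall>i. \<forall>t\<in>{0..T}. \<forall>\<omega>\<in>space M. \<bar>\<mu> i t \<omega>\<bar> \<le> C"
    and volatility: "progressive F T (\<lambda>t \<omega>. \<sigma> t \<omega> $ i $ j)"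
      "\<exists>C. \<forall>i j. \<forall>t\<in>{0..T}. \<forall>\<omega>\<in>space M. \<bar>\<sigma> t \<omega> $ i $ j\<bar> \<le> C"
    and nondegenerate: "\<exists>\<epsilon>>0. \<forall>t\<in>{0..T}. \<forall>\<omega>\<in>space M. \<forall>v. v \<noteq> 0 \<longrightarrow>
      \<epsilon> * (v \<bullet> v) < v \<bullet> ((\<sigma> t \<omega> ** transpose (\<sigma> t \<omega>)) *v v)"

text \<open>The argument \<open>I\<close> stands for the Ito integral of \<open>\<theta>\<close> over \<open>{0..t}\<close>.\<close>

definition state_price_density ::
  "(real \<Rightarrow> 'a \<Rightarrow> real) \<Rightarrow> (real \<Rightarrow> 'a \<Rightarrow> real ^ 'n) \<Rightarrow> real \<Rightarrow> ('a \<Rightarrow> real) \<Rightarrow> 'a \<Rightarrow> real" where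
  "state_price_density r \<theta> t I \<omega> =
     exp (- (LINT s:{0..t}|lborel. r s \<omega> + 1/2 * (norm (\<theta> s \<omega>))\<^sup>2) - I \<omega>)"

definition pos_part :: "real \<Rightarrow> real" where
  "pos_part a = a * indicator {0..} a"

definition H :: "'a measure \<Rightarrow> ('a \<Rightarrow> real) \<Rightarrow> real \<Rightarrow> real \<Rightarrow> real" where
  "H M z p y = (LINT \<omega>|M. z \<omega> powr p * indicator {\<omega>. z \<omega> \<le> y} \<omega>)"

definition K :: "'a measure \<Rightarrow> ('a \<Rightarrow> real) \<Rightarrow> real \<Rightarrow> real \<Rightarrow> real" where
  "K M z p y = H M z 1 y - H M z (p + 1) y / y powr p"

definition J :: "'a measure \<Rightarrow> ('a \<Rightarrow> real) \<Rightarrow> real \<Rightarrow> real \<Rightarrow> real" where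
  "J M z p y = H M z 0 y - H M z p y / y powr p"

text \<open>
  The inverse functions are taken on \<open>{0..}\<close>: the value \<open>0\<close> of \<open>H M z 1\<close>, which is needed when
  \<open>x\<^sub>0 = \<gamma> * E z\<close>, need not be attained at a positive argument.  All these functions vanish at \<open>0\<close> for
  positive \<open>z\<close> (for \<open>K\<close> this uses \<open>a / 0 = 0\<close>).  Where \<open>H M z 1\<close> is constant on an interval,
  \<open>inv_into\<close> picks one of the preimages; \<open>z\<close> has no mass between any two of them.
\<close>

definition H1_inv :: "'a measure \<Rightarrow> ('a \<Rightarrow> real) \<Rightarrow> real \<Rightarrow> real" where
  "H1_inv M z = inv_into {0..} (H M z 1)"

definition K_inv :: "'a measure \<Rightarrow> ('a \<Rightarrow> real) \<Rightarrow> real \<Rightarrow> real \<Rightarrow> real" where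
  "K_inv M z p = inv_into {0..} (K M z p)"

definition d_lower ::
  "'a measure \<Rightarrow> ('a \<Rightarrow> real) \<Rightarrow> real \<Rightarrow> real \<Rightarrow> real \<Rightarrow> real \<Rightarrow> real" where
  "d_lower M z p x\<^sub>0 \<gamma> B =
     (if x\<^sub>0 < \<gamma> * (LINT \<omega>|M. z \<omega>)
      then \<gamma> * J M z p (K_inv M z p (x\<^sub>0 / \<gamma>))
      else (B - \<gamma>) * H M z 0 (H1_inv M z ((x\<^sub>0 - \<gamma> * (LINT \<omega>|M. z \<omega>)) / (B - \<gamma>))) + \<gamma>)"

definition d_upper :: "'a measure \<Rightarrow> ('a \<Rightarrow> real) \<Rightarrow> real \<Rightarrow> real \<Rightarrow> real" where
  "d_upper M z x\<^sub>0 B = B * H M z 0 (H1_inv M z (x\<^sub>0 / B))"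

definition L2 :: "'a measure \<Rightarrow> 'a measure \<Rightarrow> ('a \<Rightarrow> real) set" where
  "L2 M G = {X \<in> borel_measurable G. integrable M (\<lambda>\<omega>. (X \<omega>)\<^sup>2)}"

definition feasible ::
  "'a measure \<Rightarrow> 'a measure \<Rightarrow> ('a \<Rightarrow> real) \<Rightarrow> real \<Rightarrow> real \<Rightarrow> real \<Rightarrow> ('a \<Rightarrow> real) set" where
  "feasible M G z x\<^sub>0 d B = {X \<in> L2 M G.
     (LINT \<omega>|M. X \<omega>) \<ge> d \<and> (LINT \<omega>|M. z \<omega> * X \<omega>) = x\<^sub>0 \<and> (AE \<omega> in M. 0 \<le> X \<omega> \<and> X \<omega> \<le> B)}"

definition objective :: "'a measure \<Rightarrow> nat \<Rightarrow> real \<Rightarrow> ('a \<Rightarrow> real) \<Rightarrow> real" where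
  "objective M q \<gamma> X = (LINT \<omega>|M. pos_part (\<gamma> - X \<omega>) ^ q)"

definition solutions ::
  "'a measure \<Rightarrow> 'a measure \<Rightarrow> ('a \<Rightarrow> real) \<Rightarrow> nat \<Rightarrow> real \<Rightarrow> real \<Rightarrow> real \<Rightarrow> real \<Rightarrow> ('a \<Rightarrow> real) set"
  where
  "solutions M G z q \<gamma> x\<^sub>0 d B = {X \<in> feasible M G z x\<^sub>0 d B.
     \<forall>Y \<in> feasible M G z x\<^sub>0 d B. objective M q \<gamma> X \<le> objective M q \<gamma> Y}"

text \<open>Random variables are identified when they agree almost surely.\<close>

definition the_solution ::
  "'a measure \<Rightarrow> 'a measure \<Rightarrow> ('a \<Rightarrow> real) \<Rightarrow> nat \<Rightarrow> real \<Rightarrow> real \<Rightarrow> real \<Rightarrow> real \<Rightarrow> ('a \<Rightarrow> real) \<Rightarrow> bool"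
  where
  "the_solution M G z q \<gamma> x\<^sub>0 d B X \<longleftrightarrow>
     X \<in> solutions M G z q \<gamma> x\<^sub>0 d B \<and>
     (\<forall>Y \<in> solutions M G z q \<gamma> x\<^sub>0 d B. AE \<omega> in M. Y \<omega> = X \<omega>)"

definition X_opt ::
  "('a \<Rightarrow> real) \<Rightarrow> nat \<Rightarrow> real \<Rightarrow> real \<Rightarrow> real \<Rightarrow> real \<Rightarrow> 'a \<Rightarrow> real" where
  "X_opt z q \<gamma> B l \<eta> \<omega> =
     B * indicator {\<omega>. \<eta> * z \<omega> \<le> l} \<omega> +
     (\<gamma> - ((\<eta> * z \<omega> - l) / q) powr (1 / (real q - 1))) *
       indicator {\<omega>. l < \<eta> * z \<omega> \<and> \<eta> * z \<omega> \<le> l + q * \<gamma> ^ (q - 1)} \<omega>"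

definition X_set ::
  "'a measure \<Rightarrow> 'a measure \<Rightarrow> ('a \<Rightarrow> real) \<Rightarrow> real \<Rightarrow> real \<Rightarrow> real \<Rightarrow> real \<Rightarrow> ('a \<Rightarrow> real) set" where
  "X_set M G z \<gamma> x\<^sub>0 d B = {Y \<in> L2 M G. (AE \<omega> in M. \<gamma> \<le> Y \<omega> \<and> Y \<omega> \<le> B) \<and>
     (LINT \<omega>|M. Y \<omega>) \<ge> d \<and> (LINT \<omega>|M. z \<omega> * Y \<omega>) = x\<^sub>0}"

definition x_star :: "'a measure \<Rightarrow> ('a \<Rightarrow> real) \<Rightarrow> real \<Rightarrow> real \<Rightarrow> real \<Rightarrow> 'a \<Rightarrow> real" where
  "x_star M z \<gamma> x\<^sub>0 B \<omega> =
     (B - \<gamma>) * indicator {\<omega>. z \<omega> \<le> H1_inv M z ((x\<^sub>0 - \<gamma> * (LINT \<omega>|M. z \<omega>)) / (B - \<gamma>))} \<omega> + \<gamma>"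

end

theory Submission
  imports Defs
begin

text \<open>
  The only facts about \<open>z\<close> that matter are that it is positive, integrable, without atoms and
  measurable at the horizon.  Pointwise, the payoff of \<open>X_opt\<close> is the strict minimiser over
  \<open>{0..B}\<close> of the Lagrangian \<open>(\<gamma> - x)\<^sub>+ ^ q + (\<eta> z - l) x\<close>, except where \<open>\<eta> z = l\<close>, a null event;
  this gives optimality and uniqueness whenever the constraints hold.

  The multipliers are found in the coordinates \<open>a = l / \<eta>\<close> (the threshold below which the payoff
  is \<open>B\<close>) and \<open>s = \<eta> / (q \<gamma> ^ (q - 1))\<close> (the slope beyond it).  For each \<open>a\<close> in an interval of
  thresholds the price of the payoff decreases strictly in \<open>s\<close>, so the budget determines \<open>s\<close> as a
  continuous function of \<open>a\<close>.  Along this curve the mean goes from the lower to the upper critical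
  value of \<open>d\<close>, and the intermediate value theorem gives the required pair.  The slope \<open>s = 0\<close> is
  included: it describes the payoff of part (iii).
\<close>

section \<open>Strict convexity of powers\<close>

text \<open>A strictly convex power lies strictly above its tangent at \<open>v\<close>. Multiplying
  the inequality for \<open>n\<close> by \<open>u\<close> gives the tangent for \<open>n + 1\<close>
  plus a nonnegative square; \<open>u = 0\<close> is treated apart because that multiplication would
  lose strictness.\<close>

lemma power_gt_tangent:
  fixes u v :: real
  assumes "2 \<le> n" "0 \<le> u" "0 \<le> v" "u \<noteq> v"
  shows "v ^ n + real n * v ^ (n - 1) * (u - v) < u ^ n"
  using assms(1)
proof (induction n rule: nat_induct_at_least)
  case base
  have "0 < (u - v)\<^sup>2" using assms by simp
  then show ?case by (simp add: power2_eq_square algebra_simps)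
next
  case (Suc n)
  obtain m where m: "n = Suc m" using Suc.hyps by (cases n) auto
  have eq: "u * (v ^ n + real n * v ^ (n - 1) * (u - v)) =
      v ^ Suc n + real (Suc n) * v ^ (Suc n - 1) * (u - v) + real n * v ^ (n - 1) * (u - v)\<^sup>2"
    by (simp add: m power2_eq_square algebra_simps)
  show ?case
  proof (cases "u = 0")
    case True
    then have "0 < v" using assms by simp
    then show ?thesis using True Suc.hyps by (simp add: algebra_simps)
  next
    case False
    then have "u * (v ^ n + real n * v ^ (n - 1) * (u - v)) < u * u ^ n"
      using assms Suc.IH by (intro mult_strict_left_mono) auto
    moreover have "0 \<le> real n * v ^ (n - 1) * (u - v)\<^sup>2" using assms by simp
    ultimately show ?thesis unfolding eq by simp
  qed
qed

section \<open>Payoff profiles as functions of the state price\<close>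

text \<open>The payoff of \<open>X_opt\<close> as one function of the state price: truncation at 0
  replaces the second indicator. At slope 0 the branch beyond the threshold is the constant
  \<open>\<gamma>\<close>, because \<open>0 powr p = 0\<close>.\<close>

definition profile :: "real \<Rightarrow> real \<Rightarrow> real \<Rightarrow> real \<Rightarrow> real \<Rightarrow> real \<Rightarrow> real" where
  "profile B \<gamma> p a s x = (if x \<le> a then B else \<gamma> * max 0 (1 - (s * (x - a)) powr p))"

lemma profile_measurable [measurable]: "profile B \<gamma> p a s \<in> borel_measurable borel"
  unfolding profile_def by measurable

lemma profile_nonneg: "0 \<le> \<gamma> \<Longrightarrow> \<gamma> \<le> B \<Longrightarrow> 0 \<le> profile B \<gamma> p a s x"
  by (simp add: profile_def)

lemma profile_le_right: "0 \<le> \<gamma> \<Longrightarrow> a < x \<Longrightarrow> profile B \<gamma> p a s x \<le> \<gamma>"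
  using mult_left_mono[of "max 0 (1 - (s * (x - a)) powr p)" 1 \<gamma>] by (simp add: profile_def)

lemma profile_le: "0 \<le> \<gamma> \<Longrightarrow> \<gamma> \<le> B \<Longrightarrow> profile B \<gamma> p a s x \<le> B"
  using profile_le_right[of \<gamma> a x B p s] by (cases "x \<le> a") (auto simp: profile_def)

lemma profile_antimono:
  "0 \<le> \<gamma> \<Longrightarrow> 0 \<le> p \<Longrightarrow> 0 \<le> s \<Longrightarrow> s \<le> s' \<Longrightarrow> profile B \<gamma> p a s' x \<le> profile B \<gamma> p a s x"
  by (auto simp: profile_def intro!: mult_left_mono max.mono powr_mono2 mult_right_mono diff_left_mono)

text \<open>Joint continuity in threshold and slope away from the jump at \<open>x = a\<close>. The
  limit slope may be 0, so the convergence of the powers relies on nonnegative bases and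
  \<open>0 < p\<close>.\<close>

lemma tendsto_profile:
  assumes "u \<longlonglongrightarrow> a" "v \<longlonglongrightarrow> s" "\<And>n. 0 \<le> v n" "x \<noteq> a" "0 < p"
  shows "(\<lambda>n. profile B \<gamma> p (u n) (v n) x) \<longlonglongrightarrow> profile B \<gamma> p a s x"
proof (cases "x < a")
  case True
  then have "\<forall>\<^sub>F n in sequentially. x < u n" using assms(1) order_tendstoD(1) by blast
  then have "\<forall>\<^sub>F n in sequentially. profile B \<gamma> p (u n) (v n) x = B"
    by eventually_elim (simp add: profile_def)
  then show ?thesis using True by (simp add: profile_def tendsto_eventually)
next
  case False
  then have ax: "a < x" using assms by simp
  then have ev: "\<forall>\<^sub>F n in sequentially. u n < x" using assms(1) order_tendstoD(2) by blast
  have "\<forall>\<^sub>F n in sequentially. 0 \<le> v n * (x - u n)"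
    using ev by eventually_elim (use assms(3) in auto)
  then have "(\<lambda>n. (v n * (x - u n)) powr p) \<longlonglongrightarrow> (s * (x - a)) powr p"
    using assms by (intro tendsto_powr2 tendsto_mult tendsto_diff tendsto_const)
  then have "(\<lambda>n. \<gamma> * max 0 (1 - (v n * (x - u n)) powr p)) \<longlonglongrightarrow> \<gamma> * max 0 (1 - (s * (x - a)) powr p)"
    by (intro tendsto_mult tendsto_max tendsto_diff tendsto_const)
  moreover have "\<forall>\<^sub>F n in sequentially.
      \<gamma> * max 0 (1 - (v n * (x - u n)) powr p) = profile B \<gamma> p (u n) (v n) x"
    using ev by eventually_elim (simp add: profile_def)
  ultimately show ?thesis using ax by (auto simp: profile_def intro: Lim_transform_eventually)
qed

section \<open>Partial moments of an atomless state price\<close>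

locale state_price = prob_space M for M :: "'a measure" +
  fixes z :: "'a \<Rightarrow> real"
  assumes z_integrable: "integrable M z"
    and z_pos: "\<And>\<omega>. 0 < z \<omega>"
    and z_atomless: "\<And>c. AE \<omega> in M. z \<omega> \<noteq> c"
begin

lemma z_measurable [measurable]: "z \<in> borel_measurable M"
  using z_integrable by simp

text \<open>The weight \<open>w\<close> is later \<open>z\<close> for prices and a constant for
  means, so that each argument about integrals serves both.\<close>

lemma integrable_weighted:
  fixes w f :: "'a \<Rightarrow> real"
  assumes "integrable M w" "f \<in> borel_measurable M" "AE \<omega> in M. \<bar>f \<omega>\<bar> \<le> C"
  shows "integrable M (\<lambda>\<omega>. w \<omega> * f \<omega>)"
proof (rule Bochner_Integration.integrable_bound)
  show "integrable M (\<lambda>\<omega>. C * w \<omega>)" using assms(1) by simp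
  show "(\<lambda>\<omega>. w \<omega> * f \<omega>) \<in> borel_measurable M" using assms by measurable
  show "AE \<omega> in M. norm (w \<omega> * f \<omega>) \<le> norm (C * w \<omega>)"
    using assms(3)
  proof eventually_elim
    case (elim \<omega>)
    then show ?case
      using mult_left_mono[of "\<bar>f \<omega>\<bar>" "\<bar>C\<bar>" "\<bar>w \<omega>\<bar>"] by (simp add: abs_mult mult.commute)
  qed
qed

lemma integrable_profile:
  assumes "integrable M w" "0 \<le> \<gamma>" "\<gamma> \<le> B"
  shows "integrable M (\<lambda>\<omega>. w \<omega> * profile B \<gamma> p a s (z \<omega>))"
  using assms profile_nonneg[of \<gamma> B p a s] profile_le[of \<gamma> B p a s]
  by (intro integrable_weighted[where C = B]) (auto simp: abs_of_nonneg)

text \<open>Dominated convergence: pointwise convergence can fail only on the event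
  \<open>z = a\<close>, which is null since \<open>z\<close> has no atoms.\<close>

lemma tendsto_integral_profile:
  assumes "integrable M w" "0 \<le> \<gamma>" "\<gamma> \<le> B" "0 < p"
    and "u \<longlonglongrightarrow> a" "v \<longlonglongrightarrow> s" "\<And>n. 0 \<le> v n"
  shows "(\<lambda>n. LINT \<omega>|M. w \<omega> * profile B \<gamma> p (u n) (v n) (z \<omega>))
    \<longlonglongrightarrow> (LINT \<omega>|M. w \<omega> * profile B \<gamma> p a s (z \<omega>))"
proof (rule integral_dominated_convergence[where w = "\<lambda>\<omega>. B * \<bar>w \<omega>\<bar>"])
  show "AE \<omega> in M. (\<lambda>n. w \<omega> * profile B \<gamma> p (u n) (v n) (z \<omega>)) \<longlonglongrightarrow> w \<omega> * profile B \<gamma> p a s (z \<omega>)"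
    using z_atomless[of a]
    by eventually_elim (intro tendsto_mult tendsto_const tendsto_profile assms)
  show "AE \<omega> in M. norm (w \<omega> * profile B \<gamma> p (u n) (v n) (z \<omega>)) \<le> B * \<bar>w \<omega>\<bar>" for n
    using profile_nonneg[of \<gamma> B p "u n" "v n"] profile_le[of \<gamma> B p "u n" "v n"] assms(2,3)
    by (intro AE_I2) (simp add: abs_mult mult.commute[of B] mult_left_mono)
qed (use assms(1) in auto)

text \<open>Positivity of \<open>z\<close> matters here, as \<open>0 powr 0 = 0\<close>. The factor
  1 keeps the shape of a weighted integral.\<close>

lemma H0_eq: "H M z 0 y = (LINT \<omega>|M. 1 * indicator {..y} (z \<omega>))"
  unfolding H_def using z_pos
  by (intro Bochner_Integration.integral_cong) (auto simp: indicator_def less_imp_neq[THEN not_sym])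

lemma H1_eq: "H M z 1 y = (LINT \<omega>|M. z \<omega> * indicator {..y} (z \<omega>))"
  unfolding H_def using z_pos[THEN less_imp_le]
  by (intro Bochner_Integration.integral_cong) (auto simp: indicator_def)

lemma integrable_indicator_z:
  "integrable M w \<Longrightarrow> integrable M (\<lambda>\<omega>. w \<omega> * indicator {..y} (z \<omega>) :: real)"
  by (intro integrable_weighted[where C = 1]) (auto simp: indicator_def)

lemma profile_indicator: "profile 1 0 p a s x = indicator {..a} x"
  by (simp add: profile_def indicator_def)

text \<open>The indicator of \<open>{..y}\<close> is a profile with cap 1 and
  \<open>\<gamma> = 0\<close>, so continuity in \<open>y\<close> is an instance of the convergence
  of profile integrals.\<close>

lemma isCont_H0: "isCont (H M z 0) y" and isCont_H1: "isCont (H M z 1) y"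
proof -
  have *: "isCont (\<lambda>y. LINT \<omega>|M. w \<omega> * indicator {..y} (z \<omega>)) y" if "integrable M w" for w :: "'a \<Rightarrow> real"
    unfolding continuous_at_sequentially comp_def
    using tendsto_integral_profile[OF that, of 0 1 1 _ y "\<lambda>_. 0" 0]
    by (simp add: profile_indicator)
  show "isCont (H M z 0) y" "isCont (H M z 1) y"
    using *[of "\<lambda>_. 1"] *[OF z_integrable] by (simp_all add: H0_eq[abs_def] H1_eq[abs_def])
qed

lemma H1_mono: "x \<le> y \<Longrightarrow> H M z 1 x \<le> H M z 1 y"
  unfolding H1_eq using z_pos[THEN less_imp_le]
  by (intro integral_mono integrable_indicator_z z_integrable mult_left_mono) (auto simp: indicator_def)

lemma H1_zero: "H M z 1 0 = 0"
proof -
  have "z \<omega> * indicator {..0} (z \<omega>) = 0" for \<omega> using z_pos[of \<omega>] by (simp add: indicator_def)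
  then show ?thesis unfolding H1_eq by (simp only: Bochner_Integration.integral_zero)
qed

text \<open>A nonnegative function with integral 0 vanishes almost surely, and the positive weight
  \<open>z\<close> cancels.\<close>

lemma AE_eq_if_weighted_integral_eq:
  assumes "integrable M (\<lambda>\<omega>. z \<omega> * f \<omega>)" "integrable M (\<lambda>\<omega>. z \<omega> * g \<omega>)"
    and "\<And>\<omega>. f \<omega> \<le> g \<omega>" and "(LINT \<omega>|M. z \<omega> * f \<omega>) = (LINT \<omega>|M. z \<omega> * g \<omega>)"
  shows "AE \<omega> in M. f \<omega> = g \<omega>"
proof -
  have "(LINT \<omega>|M. z \<omega> * g \<omega> - z \<omega> * f \<omega>) = 0" using assms by simp
  then have "AE \<omega> in M. z \<omega> * g \<omega> - z \<omega> * f \<omega> = 0"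
    using assms z_pos[THEN less_imp_le]
    by (subst (asm) integral_nonneg_eq_0_iff_AE) (auto simp: mult_left_mono)
  then show ?thesis
  proof eventually_elim
    case (elim \<omega>)
    then show ?case using z_pos[of \<omega>] by simp
  qed
qed

text \<open>Makes the preimage picked by \<open>inv_into\<close> immaterial: where
  \<open>H M z 1\<close> is flat, \<open>z\<close> carries no mass.\<close>

lemma H0_eq_if_H1_eq:
  assumes "H M z 1 x = H M z 1 y"
  shows "H M z 0 x = H M z 0 y"
  using assms
proof (induction x y rule: linorder_wlog)
  case (le x y)
  have "AE \<omega> in M. (indicator {..x} (z \<omega>) :: real) = indicator {..y} (z \<omega>)"
    using le unfolding H1_eq
    by (intro AE_eq_if_weighted_integral_eq integrable_indicator_z z_integrable)
       (auto simp: indicator_def)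
  then show ?case unfolding H0_eq by (intro integral_cong_AE) auto
qed simp

text \<open>Since \<open>H M z 1\<close> can be flat, closeness of its values cannot be transferred
  through a continuous inverse. Instead, the mass of \<open>z\<close> between \<open>x\<close> and
  \<open>y\<close> is split at a small level \<open>c\<close>: below \<open>c\<close> it is at most
  \<open>H M z 0 c\<close>, above \<open>c\<close> a Markov bound applies.\<close>

lemma H0_uniformly_continuous_in_H1:
  assumes "0 < e"
  obtains \<delta> where "0 < \<delta>"
    "\<And>x y. \<bar>H M z 1 x - H M z 1 y\<bar> < \<delta> \<Longrightarrow> \<bar>H M z 0 x - H M z 0 y\<bar> < e"
proof -
  have "indicator {..0} (z \<omega>) = (0 :: real)" for \<omega> using z_pos[of \<omega>] by (simp add: indicator_def)
  then have "H M z 0 0 = 0" by (simp add: H0_eq)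
  then obtain c where c: "0 < c" "\<bar>H M z 0 c\<bar> < e / 2"
    using isCont_H0[of 0] assms unfolding continuous_at_eps_delta dist_real_def
    by (metis abs_of_pos diff_zero dense half_gt_zero)
  have *: "\<bar>H M z 0 y - H M z 0 x\<bar> \<le> H M z 0 c + \<bar>H M z 1 y - H M z 1 x\<bar> / c" for x y
  proof (induction x y rule: linorder_wlog)
    case (le x y)
    have int: "integrable M (\<lambda>\<omega>. indicator {..y} (z \<omega>) :: real)" for y
      using integrable_indicator_z[of "\<lambda>_. 1" y] by simp
    note int' = integrable_indicator_z[OF z_integrable]
    have H0: "H M z 0 y - H M z 0 x = (LINT \<omega>|M. indicator {..y} (z \<omega>) - indicator {..x} (z \<omega>))"
      unfolding H0_eq using int by simp
    \<comment> \<open>Pointwise, a state with \<open>z\<close> between \<open>x\<close> and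
      \<open>y\<close> has \<open>z\<close> at most \<open>c\<close> or \<open>z / c\<close> above
      1.\<close>
    have "H M z 0 y - H M z 0 x \<le> (LINT \<omega>|M. indicator {..c} (z \<omega>)
        + (z \<omega> * indicator {..y} (z \<omega>) - z \<omega> * indicator {..x} (z \<omega>)) / c)"
      unfolding H0
      using int int' le c(1) z_pos
      by (intro integral_mono Bochner_Integration.integrable_add Bochner_Integration.integrable_diff
          integrable_divide) (auto simp: indicator_def field_simps less_imp_le)
    also have "\<dots> = H M z 0 c + (H M z 1 y - H M z 1 x) / c"
      unfolding H0_eq H1_eq using int int' by simp
    finally have "H M z 0 y - H M z 0 x \<le> H M z 0 c + (H M z 1 y - H M z 1 x) / c" .
    moreover have "0 \<le> H M z 0 y - H M z 0 x"
      unfolding H0 using le by (intro Bochner_Integration.integral_nonneg) (auto simp: indicator_def)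
    ultimately show ?case using H1_mono[OF le] by simp
  next
    case (sym x y)
    then show ?case by (simp add: abs_minus_commute)
  qed
  show thesis
  proof (rule that)
    show "0 < c * (e / 2)" using c assms by simp
    show "\<bar>H M z 0 x - H M z 0 y\<bar> < e" if "\<bar>H M z 1 x - H M z 1 y\<bar> < c * (e / 2)" for x y
    proof -
      have "\<bar>H M z 1 x - H M z 1 y\<bar> / c < e / 2" using that c(1) by (simp add: divide_less_eq mult.commute)
      then show ?thesis using *[of x y] c by linarith
    qed
  qed
qed

lemma H1_tendsto: "(\<lambda>n. H M z 1 (real n)) \<longlonglongrightarrow> (LINT \<omega>|M. z \<omega>)"
  unfolding H1_eq
proof (rule integral_dominated_convergence[where w = z])
  have "(\<lambda>n. z \<omega> * indicator {..real n} (z \<omega>)) \<longlonglongrightarrow> z \<omega>" for \<omega>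
  proof (rule tendsto_eventually)
    show "\<forall>\<^sub>F n in sequentially. z \<omega> * indicator {..real n} (z \<omega>) = z \<omega>"
      using eventually_ge_at_top[of "nat \<lceil>z \<omega>\<rceil>"] by eventually_elim (simp add: indicator_def; linarith)
  qed
  then show "AE \<omega> in M. (\<lambda>n. z \<omega> * indicator {..real n} (z \<omega>)) \<longlonglongrightarrow> z \<omega>" by simp
  show "AE \<omega> in M. norm (z \<omega> * indicator {..real n} (z \<omega>)) \<le> z \<omega>" for n
    using z_pos[THEN less_imp_le] by (simp add: indicator_def)
qed (use z_integrable in auto)

text \<open>Intermediate value theorem from the value 0 at 0. The expectation of \<open>z\<close>
  itself is excluded, being attained only if \<open>z\<close> is essentially bounded.\<close>

lemma H1_surj:
  assumes "0 \<le> v" "v < (LINT \<omega>|M. z \<omega>)"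
  obtains y where "0 \<le> y" "H M z 1 y = v"
proof -
  obtain n where "v < H M z 1 (real n)"
    using order_tendstoD(1)[OF H1_tendsto assms(2)] by (auto simp: eventually_sequentially)
  then show ?thesis using IVT'[of "H M z 1" 0 v "real n"] assms that isCont_H1
    by (auto simp: H1_zero continuous_at_imp_continuous_on)
qed

lemma H1_inv:
  assumes "0 \<le> v" "v < (LINT \<omega>|M. z \<omega>)"
  shows "0 \<le> H1_inv M z v" "H M z 1 (H1_inv M z v) = v"
proof -
  have "v \<in> H M z 1 ` {0..}" using H1_surj[OF assms] by (metis atLeast_iff imageI)
  then show "0 \<le> H1_inv M z v" "H M z 1 (H1_inv M z v) = v"
    unfolding H1_inv_def using inv_into_into f_inv_into_f by (metis atLeast_iff)+
qed

end

section \<open>Price and mean of a profile by threshold and slope\<close>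

text \<open>The budget is placed strictly between the prices of the constant payoffs 0 and
  \<open>B\<close>.\<close>

locale capped_problem = state_price M z for M :: "'a measure" and z +
  fixes B \<gamma> p x\<^sub>0 :: real
  assumes gamma_nonneg: "0 \<le> \<gamma>" and gamma_less: "\<gamma> < B" and p_pos: "0 < p"
    and x0_pos: "0 < x\<^sub>0" and x0_less: "x\<^sub>0 < B * (LINT \<omega>|M. z \<omega>)"
begin

definition cost :: "real \<Rightarrow> real \<Rightarrow> real" where
  "cost a s = (LINT \<omega>|M. z \<omega> * profile B \<gamma> p a s (z \<omega>))"

definition mean :: "real \<Rightarrow> real \<Rightarrow> real" where
  "mean a s = (LINT \<omega>|M. profile B \<gamma> p a s (z \<omega>))"

lemma B_pos: "0 < B"
  using gamma_nonneg gamma_less by simp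

lemma integrable_z_profile: "integrable M (\<lambda>\<omega>. z \<omega> * profile B \<gamma> p a s (z \<omega>))"
  using integrable_profile[OF z_integrable] gamma_nonneg gamma_less by simp

lemma integrable_1_profile: "integrable M (\<lambda>\<omega>. profile B \<gamma> p a s (z \<omega>))"
  using integrable_profile[of "\<lambda>_. 1"] gamma_nonneg gamma_less by simp

lemma tendsto_cost:
  "u \<longlonglongrightarrow> a \<Longrightarrow> v \<longlonglongrightarrow> s \<Longrightarrow> (\<And>n. 0 \<le> v n) \<Longrightarrow> (\<lambda>n. cost (u n) (v n)) \<longlonglongrightarrow> cost a s"
  unfolding cost_def using tendsto_integral_profile[OF z_integrable] gamma_nonneg gamma_less p_pos
  by simp

lemma tendsto_mean:
  "u \<longlonglongrightarrow> a \<Longrightarrow> v \<longlonglongrightarrow> s \<Longrightarrow> (\<And>n. 0 \<le> v n) \<Longrightarrow> (\<lambda>n. mean (u n) (v n)) \<longlonglongrightarrow> mean a s"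
  unfolding mean_def
  using tendsto_integral_profile[of "\<lambda>_. 1"] gamma_nonneg gamma_less p_pos by simp

lemma cost_antimono: "0 \<le> s \<Longrightarrow> s \<le> s' \<Longrightarrow> cost a s' \<le> cost a s"
  unfolding cost_def using z_pos[THEN less_imp_le] gamma_nonneg p_pos
  by (intro integral_mono integrable_z_profile mult_left_mono profile_antimono) auto

lemma mean_antimono: "0 \<le> s \<Longrightarrow> s \<le> s' \<Longrightarrow> mean a s' \<le> mean a s"
  unfolding mean_def using gamma_nonneg p_pos
  by (intro integral_mono integrable_1_profile profile_antimono) auto

lemma profile_ge: "B * indicator {..a} x \<le> profile B \<gamma> p a s x"
  using gamma_nonneg by (simp add: profile_def)

lemma mean_ge: "B * H M z 0 a \<le> mean a s"
proof -
  have "B * H M z 0 a = (LINT \<omega>|M. B * indicator {..a} (z \<omega>))"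
    unfolding H0_eq by simp
  also have "\<dots> \<le> mean a s"
    unfolding mean_def using integrable_indicator_z[of "\<lambda>_. B" a]
    by (intro integral_mono integrable_1_profile profile_ge) simp
  finally show ?thesis .
qed

lemma profile_slope_0: "profile B \<gamma> p a 0 x = (B - \<gamma>) * indicator {..a} x + \<gamma>"
  by (simp add: profile_def)

lemma mean_slope_0: "mean a 0 = (B - \<gamma>) * H M z 0 a + \<gamma>"
  unfolding mean_def profile_slope_0 H0_eq
  using integrable_indicator_z[of "\<lambda>_. 1" a] by (simp add: prob_space)

lemma cost_slope_0: "cost a 0 = (B - \<gamma>) * H M z 1 a + \<gamma> * (LINT \<omega>|M. z \<omega>)"
proof -
  have "cost a 0 = (LINT \<omega>|M. (B - \<gamma>) * (z \<omega> * indicator {..a} (z \<omega>)) + \<gamma> * z \<omega>)"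
    unfolding cost_def profile_slope_0 by (simp add: algebra_simps)
  then show ?thesis unfolding H1_eq
    using integrable_indicator_z[OF z_integrable, of a] z_integrable by simp
qed

lemma cost_eq_if_AE:
  assumes "AE \<omega> in M. profile B \<gamma> p a s (z \<omega>) = B * indicator {..a} (z \<omega>)"
  shows "cost a s = B * H M z 1 a"
proof -
  have "cost a s = (LINT \<omega>|M. B * (z \<omega> * indicator {..a} (z \<omega>)))"
    unfolding cost_def using assms by (intro integral_cong_AE) auto
  then show ?thesis unfolding H1_eq by simp
qed

lemma mean_eq_if_AE:
  assumes "AE \<omega> in M. profile B \<gamma> p a s (z \<omega>) = B * indicator {..a} (z \<omega>)"
  shows "mean a s = B * H M z 0 a"
proof -
  have "mean a s = (LINT \<omega>|M. B * indicator {..a} (z \<omega>))"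
    unfolding mean_def using assms by (intro integral_cong_AE) auto
  then show ?thesis unfolding H0_eq by simp
qed

text \<open>Beyond the threshold the power strictly increases with the slope, so equal values occur
  only where both payoffs are truncated to 0, or when \<open>\<gamma> = 0\<close>.\<close>

lemma profile_eq_slopeD:
  assumes "0 \<le> s" "s < s'" "profile B \<gamma> p a s' x = profile B \<gamma> p a s x"
  shows "profile B \<gamma> p a s x = B * indicator {..a} x"
proof (cases "x \<le> a \<or> \<gamma> = 0")
  case True
  then show ?thesis by (auto simp: profile_def)
next
  case False
  then have "(s * (x - a)) powr p < (s' * (x - a)) powr p"
    using assms p_pos by (intro powr_less_mono2 mult_strict_right_mono mult_nonneg_nonneg) auto
  then show ?thesis using assms(3) False by (auto simp: profile_def max_def split: if_splits)
qed

text \<open>Equal prices at two slopes would force the payoffs to agree almost surely, leaving only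
  the digital part \<open>B * indicator {..a}\<close>; its price is strictly smaller by
  hypothesis.\<close>

lemma cost_strict_antimono:
  assumes "0 \<le> s" "s < s'" "B * H M z 1 a < cost a s"
  shows "cost a s' < cost a s"
proof -
  have "cost a s' \<noteq> cost a s"
  proof
    assume "cost a s' = cost a s"
    then have "AE \<omega> in M. profile B \<gamma> p a s' (z \<omega>) = profile B \<gamma> p a s (z \<omega>)"
      using assms gamma_nonneg p_pos unfolding cost_def
      by (intro AE_eq_if_weighted_integral_eq integrable_z_profile profile_antimono) auto
    then have "AE \<omega> in M. profile B \<gamma> p a s (z \<omega>) = B * indicator {..a} (z \<omega>)"
      by eventually_elim (use assms profile_eq_slopeD in auto)
    then show False using cost_eq_if_AE assms(3) by simp
  qed
  then show ?thesis using cost_antimono[of s s' a] assms by simp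
qed

text \<open>Steep slopes squeeze out everything beyond the threshold: at a given state the payoff is
  0 once \<open>n\<close> reaches \<open>1 / (z \<omega> - a)\<close>.\<close>

lemma tendsto_cost_infinite_slope: "(\<lambda>n. cost a (real n)) \<longlonglongrightarrow> B * H M z 1 a"
proof -
  have "(\<lambda>n. LINT \<omega>|M. z \<omega> * profile B \<gamma> p a (real n) (z \<omega>)) \<longlonglongrightarrow>
      (LINT \<omega>|M. z \<omega> * (B * indicator {..a} (z \<omega>)))"
  proof (rule integral_dominated_convergence[where w = "\<lambda>\<omega>. B * z \<omega>"])
    have "(\<lambda>n. z \<omega> * profile B \<gamma> p a (real n) (z \<omega>)) \<longlonglongrightarrow> z \<omega> * (B * indicator {..a} (z \<omega>))" for \<omega>
    proof (cases "z \<omega> \<le> a")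
      case False
      then have za: "0 < z \<omega> - a" by simp
      have "\<forall>\<^sub>F n in sequentially. profile B \<gamma> p a (real n) (z \<omega>) = 0"
        using eventually_ge_at_top[of "nat \<lceil>1 / (z \<omega> - a)\<rceil>"]
      proof eventually_elim
        case (elim n)
        then have "1 / (z \<omega> - a) \<le> real n" by linarith
        then have "1 \<le> real n * (z \<omega> - a)" using za by (simp add: divide_le_eq)
        then have "1 \<le> (real n * (z \<omega> - a)) powr p" using p_pos by (simp add: ge_one_powr_ge_zero)
        then show ?case using False by (simp add: profile_def)
      qed
      then show ?thesis using False
        by (auto intro!: tendsto_eventually elim: eventually_mono)
    qed (simp add: profile_def)
    then show "AE \<omega> in M. (\<lambda>n. z \<omega> * profile B \<gamma> p a (real n) (z \<omega>)) \<longlonglongrightarrow>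
      z \<omega> * (B * indicator {..a} (z \<omega>))" by simp
    show "AE \<omega> in M. norm (z \<omega> * profile B \<gamma> p a (real n) (z \<omega>)) \<le> B * z \<omega>" for n
      using profile_nonneg[of \<gamma> B p a "real n"] profile_le[of \<gamma> B p a "real n"] gamma_nonneg gamma_less
        z_pos
      by (intro AE_I2) (simp add: abs_mult mult.commute[of B] mult_left_mono less_imp_le)
  qed (use z_integrable in auto)
  then show ?thesis unfolding cost_def H1_eq by (simp add: mult.left_commute)
qed

text \<open>The bounds on \<open>x\<close> are the limiting price for infinite slope and the price
  at slope 0; the intermediate value theorem applies in between.\<close>

lemma cost_surj:
  assumes "B * H M z 1 a < x" "x < (B - \<gamma>) * H M z 1 a + \<gamma> * (LINT \<omega>|M. z \<omega>)"
  obtains s where "0 < s" "cost a s = x"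
proof -
  obtain n where n: "cost a (real n) < x"
    using order_tendstoD(2)[OF tendsto_cost_infinite_slope assms(1)]
    by (auto simp: eventually_sequentially)
  have "continuous_on {0..real n} (cost a)"
    unfolding continuous_on_sequentially comp_def by (auto intro: tendsto_cost)
  moreover have 0: "x < cost a 0" using assms(2) by (simp add: cost_slope_0)
  ultimately obtain s where "0 \<le> s" "cost a s = x"
    using IVT2'[of "cost a" "real n" x 0] n by auto
  then show ?thesis using that[of s] 0 by (cases "s = 0") auto
qed

section \<open>Threshold zero and the functions \<open>K\<close> and \<open>J\<close>\<close>

lemma powr_mult_indicator_integrable:
  assumes "integrable M w" "0 \<le> y"
  shows "integrable M (\<lambda>\<omega>. w \<omega> * (z \<omega> powr p * indicator {..y} (z \<omega>)))"
proof (rule integrable_weighted[OF assms(1)])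
  have "\<bar>z \<omega> powr p * indicator {..y} (z \<omega>)\<bar> \<le> y powr p" for \<omega>
    using z_pos[of \<omega>] p_pos by (auto simp: indicator_def intro: powr_mono2)
  then show "AE \<omega> in M. \<bar>z \<omega> powr p * indicator {..y} (z \<omega>)\<bar> \<le> y powr p" by simp
qed auto

text \<open>At threshold 0 a positive state price never earns \<open>B\<close>, and slope
  \<open>1 / y\<close> makes the payoff reach 0 at \<open>y\<close>. Integrating this form yields
  \<open>K\<close> as price and \<open>J\<close> as mean.\<close>

lemma profile_zero_threshold:
  assumes "0 < x" "0 < y"
  shows "profile B \<gamma> p 0 (1 / y) x = \<gamma> * (indicator {..y} x - x powr p * indicator {..y} x / y powr p)"
proof (cases "x \<le> y")
  case True
  then have "x powr p \<le> y powr p" using assms p_pos by (intro powr_mono2) auto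
  then show ?thesis using True assms by (simp add: profile_def powr_divide max_def)
next
  case False
  then have "y powr p < x powr p" using assms p_pos by (intro powr_less_mono2) auto
  then show ?thesis using False assms by (simp add: profile_def powr_divide max_def)
qed

lemma cost_zero_threshold:
  assumes "0 < y"
  shows "cost 0 (1 / y) = \<gamma> * K M z p y"
proof -
  have "cost 0 (1 / y) = (LINT \<omega>|M. \<gamma> * (z \<omega> * indicator {..y} (z \<omega>)
      - z \<omega> * (z \<omega> powr p * indicator {..y} (z \<omega>)) / y powr p))"
    unfolding cost_def using assms z_pos
    by (intro Bochner_Integration.integral_cong) (simp_all add: profile_zero_threshold algebra_simps)
  also have "\<dots> = \<gamma> * (H M z 1 y - (LINT \<omega>|M. z \<omega> * (z \<omega> powr p * indicator {..y} (z \<omega>))) / y powr p)"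
    using integrable_indicator_z[OF z_integrable, of y] powr_mult_indicator_integrable[OF z_integrable, of y]
      assms by (simp add: H1_eq)
  also have "(LINT \<omega>|M. z \<omega> * (z \<omega> powr p * indicator {..y} (z \<omega>))) = H M z (p + 1) y"
    unfolding H_def using z_pos
    by (intro Bochner_Integration.integral_cong) (auto simp: powr_add indicator_def less_imp_le)
  finally show ?thesis by (simp add: K_def)
qed

lemma mean_zero_threshold:
  assumes "0 < y"
  shows "mean 0 (1 / y) = \<gamma> * J M z p y"
proof -
  have "mean 0 (1 / y) = (LINT \<omega>|M. \<gamma> * (1 * indicator {..y} (z \<omega>)
      - 1 * (z \<omega> powr p * indicator {..y} (z \<omega>)) / y powr p))"
    unfolding mean_def using assms z_pos
    by (intro Bochner_Integration.integral_cong) (simp_all add: profile_zero_threshold algebra_simps)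
  also have "\<dots> = \<gamma> * (H M z 0 y - (LINT \<omega>|M. 1 * (z \<omega> powr p * indicator {..y} (z \<omega>))) / y powr p)"
    unfolding H0_eq
    using integrable_indicator_z[of "\<lambda>_. 1" y] powr_mult_indicator_integrable[of "\<lambda>_. 1" y]
      assms by simp
  also have "(LINT \<omega>|M. 1 * (z \<omega> powr p * indicator {..y} (z \<omega>))) = H M z p y"
    unfolding H_def
    by (intro Bochner_Integration.integral_cong) (auto simp: indicator_def)
  finally show ?thesis by (simp add: J_def)
qed

lemma K_zero: "K M z p 0 = 0"
  by (simp add: K_def H1_zero)

text \<open>The value of \<open>K_inv\<close> is the reciprocal of a slope that meets the budget at
  threshold 0. This is the payoff whose mean is the lower critical value.\<close>

lemma K_inv:
  assumes "x\<^sub>0 < \<gamma> * (LINT \<omega>|M. z \<omega>)"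
  defines "y \<equiv> K_inv M z p (x\<^sub>0 / \<gamma>)"
  shows "0 < y" "cost 0 (1 / y) = x\<^sub>0" "mean 0 (1 / y) = d_lower M z p x\<^sub>0 \<gamma> B"
proof -
  have g: "0 < \<gamma>" using assms(1) x0_pos gamma_nonneg by (cases "\<gamma> = 0") auto
  obtain s where s: "0 < s" "cost 0 s = x\<^sub>0"
    using cost_surj[of 0 x\<^sub>0] assms(1) x0_pos by (auto simp: H1_zero)
  then have "K M z p (1 / s) = x\<^sub>0 / \<gamma>"
    using cost_zero_threshold[of "1 / s"] g by (simp add: field_simps)
  then have "x\<^sub>0 / \<gamma> \<in> K M z p ` {0..}" using s by (metis atLeast_iff divide_nonneg_pos image_eqI zero_le_one)
  then have y: "0 \<le> y" "K M z p y = x\<^sub>0 / \<gamma>"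
    unfolding y_def K_inv_def using inv_into_into f_inv_into_f by (metis atLeast_iff)+
  \<comment> \<open>By \<open>a / 0 = 0\<close> the function \<open>K\<close> vanishes at 0, whereas
    its value at \<open>y\<close> is positive.\<close>
  then show y0: "0 < y" using K_zero x0_pos g by (cases "y = 0") auto
  show "cost 0 (1 / y) = x\<^sub>0" using cost_zero_threshold[OF y0] y g by simp
  show "mean 0 (1 / y) = d_lower M z p x\<^sub>0 \<gamma> B"
    using mean_zero_threshold[OF y0] assms(1) by (simp add: d_lower_def y_def)
qed


section \<open>The budget curve in threshold and slope\<close>

text \<open>The slope dictated by the budget. For \<open>a\<close> in \<open>thresholds\<close> the
  choice is forced, see \<open>slope_eqI\<close>.\<close>

definition slope :: "real \<Rightarrow> real" where
  "slope a = (SOME s. 0 < s \<and> cost a s = x\<^sub>0)"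

text \<open>The two strict inequalities say that the budget lies between the prices for infinite
  slope and for slope 0.\<close>

definition thresholds :: "real set" where
  "thresholds = {a. 0 \<le> a \<and> B * H M z 1 a < x\<^sub>0 \<and>
     x\<^sub>0 < (B - \<gamma>) * H M z 1 a + \<gamma> * (LINT \<omega>|M. z \<omega>)}"

lemma slope:
  assumes "a \<in> thresholds"
  shows "0 < slope a" "cost a (slope a) = x\<^sub>0"
proof -
  have "\<exists>s. 0 < s \<and> cost a s = x\<^sub>0"
    using cost_surj[of a x\<^sub>0] assms by (auto simp: thresholds_def)
  from someI_ex[OF this] show "0 < slope a" "cost a (slope a) = x\<^sub>0" by (simp_all add: slope_def)
qed

lemma slope_eqI:
  assumes "a \<in> thresholds" "0 < s" "cost a s = x\<^sub>0"
  shows "slope a = s"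
proof (rule ccontr)
  assume "slope a \<noteq> s"
  moreover have "B * H M z 1 a < x\<^sub>0" using assms(1) by (simp add: thresholds_def)
  ultimately show False
    using cost_strict_antimono[of s "slope a" a] cost_strict_antimono[of "slope a" s a] slope[OF assms(1)]
      assms(2,3) by linarith
qed

text \<open>A monotone form of the implicit function theorem: a slope below \<open>slope a\<close>
  costs strictly more than the budget at \<open>a\<close>, hence also at nearby thresholds, where
  antitonicity in the slope puts it below the budget slope. Slopes above are treated in the same
  way.\<close>

lemma tendsto_slope:
  assumes "u \<longlonglongrightarrow> a" "\<And>n. u n \<in> thresholds" "a \<in> thresholds"
  shows "(\<lambda>n. slope (u n)) \<longlonglongrightarrow> slope a"
proof (rule order_tendstoI)
  note a = slope[OF assms(3)]
  have strict: "B * H M z 1 a < x\<^sub>0" using assms(3) by (simp add: thresholds_def)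
  have cont: "(\<lambda>n. cost (u n) s) \<longlonglongrightarrow> cost a s" if "0 \<le> s" for s
    using tendsto_cost[OF assms(1) tendsto_const] that by simp
  {
    fix s assume "s < slope a"
    \<comment> \<open>The price is antitone only for nonnegative slopes, so a negative lower bound
      is raised to 0.\<close>
    define s' where "s' = max s 0"
    have s': "0 \<le> s'" "s' < slope a" using \<open>s < slope a\<close> a by (auto simp: s'_def)
    have "x\<^sub>0 < cost a s'"
      using cost_strict_antimono[of s' "slope a" a] cost_antimono[of s' "slope a" a] s' a strict by simp
    from order_tendstoD(1)[OF cont[OF s'(1)] this]
    show "\<forall>\<^sub>F n in sequentially. s < slope (u n)"
    proof eventually_elim
      case (elim n)
      have "s' < slope (u n)"
        using cost_antimono[of "slope (u n)" s' "u n"] slope[OF assms(2)[of n]] elim by linarith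
      then show ?case by (simp add: s'_def)
    qed
  next
    fix s assume s: "slope a < s"
    then have "cost a s < x\<^sub>0" using cost_strict_antimono[of "slope a" s a] a strict by simp
    moreover have "0 \<le> s" using s a by simp
    ultimately have "\<forall>\<^sub>F n in sequentially. cost (u n) s < x\<^sub>0"
      using order_tendstoD(2)[OF cont] by blast
    then show "\<forall>\<^sub>F n in sequentially. slope (u n) < s"
    proof eventually_elim
      case (elim n)
      then show ?case
        using cost_antimono[of s "slope (u n)" "u n"] slope[OF assms(2)[of n]] \<open>0 \<le> s\<close> by linarith
    qed
  }
qed

lemma continuous_on_mean_slope: "continuous_on thresholds (\<lambda>a. mean a (slope a))"
  unfolding continuous_on_sequentially comp_def
  using slope(1) by (auto intro!: tendsto_mean tendsto_slope less_imp_le)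

lemma connected_thresholds: "connected thresholds"
proof -
  have "is_interval thresholds"
    unfolding is_interval_1
  proof (intro ballI allI impI)
    fix a b x assume ab: "a \<in> thresholds" "b \<in> thresholds" and x: "a \<le> x \<and> x \<le> b"
    then have "B * H M z 1 x \<le> B * H M z 1 b" "(B - \<gamma>) * H M z 1 a \<le> (B - \<gamma>) * H M z 1 x"
      using H1_mono B_pos gamma_less by (auto intro!: mult_left_mono)
    then show "x \<in> thresholds" using ab x by (auto simp: thresholds_def)
  qed
  then show ?thesis by (simp add: is_interval_connected_1)
qed

lemma x0_div_B: "0 < x\<^sub>0 / B" "x\<^sub>0 / B < (LINT \<omega>|M. z \<omega>)"
  using x0_pos x0_less B_pos by (auto simp: divide_less_eq mult.commute)


section \<open>Critical means and the intermediate value argument\<close>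

text \<open>The value that \<open>H M z 1\<close> must take at a threshold for the payoff with slope
  0 to meet the budget.\<close>

definition excess :: real where
  "excess = (x\<^sub>0 - \<gamma> * (LINT \<omega>|M. z \<omega>)) / (B - \<gamma>)"

lemma excess_less: "0 < \<gamma> \<Longrightarrow> excess < x\<^sub>0 / B"
  using x0_less B_pos gamma_less by (simp add: excess_def divide_simps algebra_simps)

lemma thresholds_iff:
  "a \<in> thresholds \<longleftrightarrow> 0 \<le> a \<and> H M z 1 a < x\<^sub>0 / B \<and> excess < H M z 1 a"
  using B_pos gamma_less by (auto simp: thresholds_def excess_def field_simps)

text \<open>The upper critical value is the mean of the digital payoff that spends the whole budget,
  the limiting case of infinite slope.\<close>

lemma d_upper_H1_inv:
  assumes "H M z 1 a = x\<^sub>0 / B"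
  shows "d_upper M z x\<^sub>0 B = B * H M z 0 a"
proof -
  have "H M z 0 (H1_inv M z (x\<^sub>0 / B)) = H M z 0 a"
    using H1_inv[of "x\<^sub>0 / B"] x0_div_B assms by (intro H0_eq_if_H1_eq) simp
  then show ?thesis by (simp add: d_upper_def)
qed

lemma d_lower_H1_inv:
  assumes "\<gamma> * (LINT \<omega>|M. z \<omega>) \<le> x\<^sub>0"
  defines "y \<equiv> H1_inv M z excess"
  shows "0 \<le> y" "H M z 1 y = excess" "d_lower M z p x\<^sub>0 \<gamma> B = mean y 0"
proof -
  have "0 \<le> excess" using assms gamma_less by (simp add: excess_def)
  moreover have "excess < (LINT \<omega>|M. z \<omega>)"
    using x0_less gamma_less by (simp add: excess_def divide_less_eq algebra_simps)
  ultimately show "0 \<le> y" "H M z 1 y = excess" unfolding y_def by (fact H1_inv)+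
  show "d_lower M z p x\<^sub>0 \<gamma> B = mean y 0"
    using assms by (simp add: d_lower_def mean_slope_0 excess_def)
qed

text \<open>For \<open>\<gamma> = 0\<close> the two critical values coincide.\<close>

lemma gamma_pos_if_d_lower_less:
  assumes "d_lower M z p x\<^sub>0 \<gamma> B < d_upper M z x\<^sub>0 B"
  shows "0 < \<gamma>"
proof (rule ccontr)
  assume "\<not> 0 < \<gamma>"
  then have "\<gamma> = 0" using gamma_nonneg by simp
  then show False using assms x0_pos by (simp add: d_lower_def d_upper_def)
qed

text \<open>If the budget cannot buy \<open>\<gamma>\<close>, threshold 0 attains the lower critical
  value. Otherwise thresholds with \<open>H M z 1\<close> slightly above \<open>excess\<close> have
  a mean at slope 0 close to it, and a positive slope can only lower the mean.\<close>

lemma exists_low_threshold: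
  assumes "0 < \<gamma>" "d_lower M z p x\<^sub>0 \<gamma> B < d"
  obtains a where "a \<in> thresholds" "mean a (slope a) < d"
proof (cases "x\<^sub>0 < \<gamma> * (LINT \<omega>|M. z \<omega>)")
  case True
  then have 0: "0 \<in> thresholds" using x0_pos by (simp add: thresholds_def H1_zero)
  then have "slope 0 = 1 / K_inv M z p (x\<^sub>0 / \<gamma>)"
    using K_inv[OF True] by (intro slope_eqI) auto
  then show ?thesis using that[OF 0] K_inv[OF True] assms(2) by simp
next
  case False
  define y where "y = H1_inv M z excess"
  have y: "H M z 1 y = excess" "mean y 0 < d" "0 \<le> excess"
    using d_lower_H1_inv False assms(2) gamma_less by (auto simp: y_def excess_def)
  then have "0 < (d - mean y 0) / (B - \<gamma>)" using gamma_less by simp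
  from H0_uniformly_continuous_in_H1[OF this] obtain \<delta> where \<delta>: "0 < \<delta>"
    "\<And>x y'. \<bar>H M z 1 x - H M z 1 y'\<bar> < \<delta> \<Longrightarrow> \<bar>H M z 0 x - H M z 0 y'\<bar> < (d - mean y 0) / (B - \<gamma>)"
    by blast
  obtain w where w: "excess < w" "w < min (excess + \<delta>) (x\<^sub>0 / B)"
    using dense[of excess "min (excess + \<delta>) (x\<^sub>0 / B)"] excess_less[OF assms(1)] \<delta>(1) by auto
  then obtain a where a: "0 \<le> a" "H M z 1 a = w"
    using H1_surj[of w] x0_div_B y(3) by auto
  then have "H M z 0 a - H M z 0 y < (d - mean y 0) / (B - \<gamma>)"
    using \<delta>(2)[of a y] w y(1) by simp
  then have "(B - \<gamma>) * (H M z 0 a - H M z 0 y) < d - mean y 0"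
    using gamma_less by (simp add: less_divide_eq mult.commute)
  then have "mean a 0 < d" by (simp add: mean_slope_0 algebra_simps)
  moreover have th: "a \<in> thresholds" using a w by (simp add: thresholds_iff)
  ultimately show ?thesis
    using that mean_antimono[of 0 "slope a" a] slope(1)[OF th] by force
qed

text \<open>For \<open>H M z 1\<close> slightly below \<open>x\<^sub>0 / B\<close> the digital part
  alone has a mean above \<open>d\<close>, whatever the slope.\<close>

lemma exists_high_threshold:
  assumes "0 < \<gamma>" "d < d_upper M z x\<^sub>0 B"
  obtains a where "a \<in> thresholds" "d < mean a (slope a)"
proof -
  obtain y where y: "H M z 1 y = x\<^sub>0 / B"
    using H1_surj[of "x\<^sub>0 / B"] x0_div_B by auto
  have dy: "d < B * H M z 0 y" using assms(2) d_upper_H1_inv[OF y] by simp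
  then have "0 < (B * H M z 0 y - d) / B" using B_pos by simp
  from H0_uniformly_continuous_in_H1[OF this] obtain \<delta> where \<delta>: "0 < \<delta>"
    "\<And>x y'. \<bar>H M z 1 x - H M z 1 y'\<bar> < \<delta> \<Longrightarrow> \<bar>H M z 0 x - H M z 0 y'\<bar> < (B * H M z 0 y - d) / B"
    by blast
  \<comment> \<open>The bound 0 keeps \<open>w\<close> in the range of \<open>H M z 1\<close> on
    \<open>{0..}\<close> when \<open>excess\<close> is negative.\<close>
  obtain w where w: "max (max excess 0) (x\<^sub>0 / B - \<delta>) < w" "w < x\<^sub>0 / B"
    using dense[of "max (max excess 0) (x\<^sub>0 / B - \<delta>)" "x\<^sub>0 / B"] excess_less[OF assms(1)] \<delta>(1)
      x0_div_B by auto
  then obtain a where a: "0 \<le> a" "H M z 1 a = w"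
    using H1_surj[of w] x0_div_B by auto
  then have "H M z 0 y - H M z 0 a < (B * H M z 0 y - d) / B"
    using \<delta>(2)[of y a] w y(1) by simp
  then have "d < B * H M z 0 a"
    using B_pos by (simp add: less_divide_eq algebra_simps)
  moreover have "a \<in> thresholds" using a w by (simp add: thresholds_iff)
  ultimately show ?thesis using that mean_ge[of a "slope a"] by force
qed

lemma exists_profile:
  assumes "d_lower M z p x\<^sub>0 \<gamma> B < d" "d < d_upper M z x\<^sub>0 B"
  obtains a s where "0 < a" "0 < s" "mean a s = d" "cost a s = x\<^sub>0"
proof -
  have g: "0 < \<gamma>" using gamma_pos_if_d_lower_less assms by simp
  obtain a1 where a1: "a1 \<in> thresholds" "mean a1 (slope a1) < d"
    using exists_low_threshold[OF g assms(1)] .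
  obtain a2 where a2: "a2 \<in> thresholds" "d < mean a2 (slope a2)"
    using exists_high_threshold[OF g assms(2)] .
  have "connected ((\<lambda>a. mean a (slope a)) ` thresholds)"
    by (intro connected_continuous_image continuous_on_mean_slope connected_thresholds)
  then have "d \<in> (\<lambda>a. mean a (slope a)) ` thresholds"
    using connectedD_interval[of _ "mean a1 (slope a1)" "mean a2 (slope a2)" d] a1 a2 by force
  then obtain a where a: "a \<in> thresholds" "mean a (slope a) = d" by blast
  \<comment> \<open>Threshold 0 would give exactly the lower critical mean, which \<open>d\<close>
    exceeds; this makes the multiplier \<open>l\<close> positive.\<close>
  have "a \<noteq> 0"
  proof
    assume "a = 0"
    then have less: "x\<^sub>0 < \<gamma> * (LINT \<omega>|M. z \<omega>)" using a by (simp add: thresholds_def H1_zero)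
    have "slope 0 = 1 / K_inv M z p (x\<^sub>0 / \<gamma>)"
      using K_inv[OF less] a \<open>a = 0\<close> by (intro slope_eqI) auto
    then show False using K_inv[OF less] a assms(1) \<open>a = 0\<close> by simp
  qed
  then have "0 < a" using a by (simp add: thresholds_def)
  then show ?thesis using that slope[OF a(1)] a(2) by blast
qed

text \<open>If the profiles agree almost surely, then either the middle piece has probability zero, which
  leads to the maximal mean, or two affine functions of \<open>z\<close> agree with positive probability.\<close>

lemma profile_unique:
  assumes "0 < \<gamma>" "0 < s" "0 < s'" "cost a s = x\<^sub>0" "mean a s < d_upper M z x\<^sub>0 B"
    and eq: "AE \<omega> in M. profile B \<gamma> p a s (z \<omega>) = profile B \<gamma> p a' s' (z \<omega>)"
  shows "a = a' \<and> s = s'"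
proof (rule ccontr)
  assume neq: "\<not> (a = a' \<and> s = s')"
  \<comment> \<open>For different slopes, \<open>c\<close> is where the lines
    \<open>s * (x - a)\<close> and \<open>s' * (x - a')\<close> cross, and \<open>z\<close> avoids
    it almost surely. For equal slopes, equality of the lines already forces
    \<open>a = a'\<close>.\<close>
  define c where "c = (s * a - s' * a') / (s - s')"
  have "AE \<omega> in M. profile B \<gamma> p a s (z \<omega>) = B * indicator {..a} (z \<omega>)"
    using eq z_atomless[of c]
  proof eventually_elim
    case (elim \<omega>)
    show ?case
    proof (rule ccontr)
      assume *: "profile B \<gamma> p a s (z \<omega>) \<noteq> B * indicator {..a} (z \<omega>)"
      then have za: "a < z \<omega>" by (auto simp: profile_def split: if_splits)
      \<comment> \<open>Beyond its own threshold the first payoff is at most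
        \<open>\<gamma>\<close>, hence below \<open>B\<close>, so the second payoff must be beyond
        its threshold too.\<close>
      then have za': "a' < z \<omega>"
        using elim profile_le_right[of \<gamma> a "z \<omega>" B p s] assms(1) gamma_less
        by (fastforce simp: profile_def[of B \<gamma> p a'] split: if_splits)
      have "(s * (z \<omega> - a)) powr p = (s' * (z \<omega> - a')) powr p"
        using * za za' elim(1) assms(1) by (auto simp: profile_def max_def split: if_splits)
      moreover have "0 < s * (z \<omega> - a)" "0 < s' * (z \<omega> - a')" using za za' assms by simp_all
      ultimately have "s * (z \<omega> - a) = s' * (z \<omega> - a')"
        using p_pos powr_less_mono2 by (metis less_imp_le linorder_neqE_linordered_idom less_irrefl)
      then have lin: "(s - s') * z \<omega> = s * a - s' * a'" by (simp add: algebra_simps)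
      show False
      proof (cases "s = s'")
        case True
        then show ?thesis using lin neq assms(2) by auto
      next
        case False
        then show ?thesis using lin elim(2) by (simp add: c_def field_simps)
      qed
    qed
  qed
  then have "x\<^sub>0 = B * H M z 1 a" "mean a s = B * H M z 0 a"
    using cost_eq_if_AE mean_eq_if_AE assms(4) by auto
  then show False using d_upper_H1_inv[of a] B_pos assms(5) by simp
qed

end

section \<open>Pointwise minimisation of the Lagrangian\<close>

lemma pos_part_eq: "pos_part a = max 0 a"
  by (simp add: pos_part_def indicator_def)

text \<open>For negative \<open>w\<close> both terms favour \<open>B\<close>. For positive
  \<open>w\<close> the value at \<open>x\<close> is bounded below by
  \<open>u ^ q + w * (\<gamma> - u)\<close> in the shortfall \<open>u\<close>, and the tangent
  inequality at the optimal shortfall \<open>v\<close> bounds this in turn.\<close>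

lemma lagrangian_less:
  assumes "1 < q" "0 < \<gamma>" "\<gamma> < B" "w \<noteq> 0" "0 \<le> x" "x \<le> B"
  defines "y \<equiv> if w < 0 then B
    else \<gamma> * max 0 (1 - (w / (real q * \<gamma> ^ (q - 1))) powr (1 / (real q - 1)))"
  assumes "x \<noteq> y"
  shows "pos_part (\<gamma> - y) ^ q + w * y < pos_part (\<gamma> - x) ^ q + w * x"
proof (cases "w < 0")
  case True
  then have y: "y = B" by (simp add: y_def)
  then have "w * y < w * x" using assms True by simp
  moreover have "pos_part (\<gamma> - y) ^ q = 0" using assms(1,3) y by (simp add: pos_part_eq power_0_left)
  moreover have "0 \<le> pos_part (\<gamma> - x) ^ q" by (simp add: pos_part_eq)
  ultimately show ?thesis by linarith
next
  case False
  then have w: "0 < w" using assms by simp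
  define t where "t = w / (real q * \<gamma> ^ (q - 1))"
  have t: "0 < t" "w = t * (real q * \<gamma> ^ (q - 1))" using w assms by (auto simp: t_def)
  define v where "v = \<gamma> * min 1 (t powr (1 / (real q - 1)))"
  have yv: "y = \<gamma> - v" unfolding y_def v_def t_def[symmetric] using False
    by (simp add: max_def min_def right_diff_distrib)
  have v: "0 \<le> v" "v \<le> \<gamma>" using assms(2) by (auto simp: v_def mult_le_cancel_left1)
  \<comment> \<open>The first-order condition for the shortfall on \<open>{0..\<gamma>}\<close>,
    with the corner \<open>v = \<gamma>\<close> when the price is high.\<close>
  have vw: "v = \<gamma> \<and> real q * v ^ (q - 1) \<le> w \<or> real q * v ^ (q - 1) = w"
  proof (cases "t \<le> 1")
    case True
    then have "t powr (1 / (real q - 1)) \<le> 1" using t assms(1) by (intro powr_le1) auto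
    then have "v ^ (q - 1) = \<gamma> ^ (q - 1) * (t powr (1 / (real q - 1))) ^ (q - 1)"
      by (simp add: v_def min_def power_mult_distrib)
    also have "(t powr (1 / (real q - 1))) ^ (q - 1) = t"
      using t assms(1) by (simp add: powr_powr of_nat_diff flip: powr_realpow)
    finally show ?thesis using t by simp
  next
    case False
    then have "1 \<le> t powr (1 / (real q - 1))" using assms(1) by (intro ge_one_powr_ge_zero) auto
    then have "v = \<gamma>" by (simp add: v_def)
    moreover have "1 * (real q * \<gamma> ^ (q - 1)) \<le> w"
      unfolding t(2) using False assms(2) by (intro mult_right_mono) auto
    ultimately show ?thesis by simp
  qed
  define u where "u = pos_part (\<gamma> - x)"
  have u: "0 \<le> u" "u \<le> \<gamma>" "\<gamma> - u \<le> x" using assms by (auto simp: u_def pos_part_eq)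
  have wx: "w * (\<gamma> - u) \<le> w * x" using u w by simp
  have pv: "pos_part (\<gamma> - y) = v" using v by (simp add: yv pos_part_eq)
  show ?thesis
  proof (cases "u = v")
    case True
    then have "y < x" using u yv assms by simp
    then show ?thesis using w True by (simp add: pv flip: u_def)
  next
    case False
    \<comment> \<open>At the corner \<open>u - v\<close> is nonpositive, so multiplication reverses
      the inequality in \<open>vw\<close>.\<close>
    have "w * (u - v) \<le> real q * v ^ (q - 1) * (u - v)"
      using vw u by (auto intro: mult_right_mono_neg)
    then have "v ^ q + w * (u - v) < u ^ q"
      using power_gt_tangent[of q u v] False u v assms(1) by simp
    then have "v ^ q + w * (\<gamma> - v) < u ^ q + w * x" using wx by (simp add: algebra_simps)
    then show ?thesis unfolding pv u_def[symmetric] unfolding yv .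
  qed
qed

text \<open>Factoring out \<open>q * \<gamma> ^ (q - 1)\<close> leaves \<open>t\<close>: the
  exponent \<open>1 / (q - 1)\<close> turns \<open>\<gamma> ^ (q - 1)\<close> into
  \<open>\<gamma>\<close>, and the upper cutoff becomes \<open>t \<le> 1\<close>, which is where the
  truncation at 0 sets in.\<close>

lemma X_opt_eq_profile:
  assumes "1 < q" "0 < \<gamma>" "0 < \<eta>"
  shows "X_opt z q \<gamma> B l \<eta> \<omega> =
    profile B \<gamma> (1 / (real q - 1)) (l / \<eta>) (\<eta> / (real q * \<gamma> ^ (q - 1))) (z \<omega>)"
proof -
  define t where "t = (\<eta> * z \<omega> - l) / (real q * \<gamma> ^ (q - 1))"
  have d0: "0 < real q * \<gamma> ^ (q - 1)" using assms by simp
  have t: "\<eta> / (real q * \<gamma> ^ (q - 1)) * (z \<omega> - l / \<eta>) = t"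
    using assms d0 by (simp add: t_def field_simps)
  have le: "z \<omega> \<le> l / \<eta> \<longleftrightarrow> \<eta> * z \<omega> \<le> l" using assms by (simp add: le_divide_eq mult.commute)
  show ?thesis
  proof (cases "\<eta> * z \<omega> \<le> l")
    case True
    then show ?thesis by (simp add: X_opt_def profile_def le)
  next
    case False
    then have t0: "0 < t" using d0 by (simp add: t_def)
    have "(\<eta> * z \<omega> - l) / real q = \<gamma> ^ (q - 1) * t" using assms by (simp add: t_def)
    then have "((\<eta> * z \<omega> - l) / real q) powr (1 / (real q - 1)) =
        (\<gamma> ^ (q - 1)) powr (1 / (real q - 1)) * t powr (1 / (real q - 1))"
      using assms t0 by (simp add: powr_mult)
    also have "(\<gamma> ^ (q - 1)) powr (1 / (real q - 1)) = \<gamma>"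
      using assms by (simp add: powr_powr of_nat_diff flip: powr_realpow)
    finally have *: "((\<eta> * z \<omega> - l) / real q) powr (1 / (real q - 1)) = \<gamma> * t powr (1 / (real q - 1))" .
    have t1: "\<eta> * z \<omega> \<le> l + real q * \<gamma> ^ (q - 1) \<longleftrightarrow> t \<le> 1"
      using d0 by (auto simp: t_def divide_le_eq)
    show ?thesis
    proof (cases "t \<le> 1")
      case True
      then have "t powr (1 / (real q - 1)) \<le> 1" using t0 assms(1) by (intro powr_le1) auto
      then have "profile B \<gamma> (1 / (real q - 1)) (l / \<eta>) (\<eta> / (real q * \<gamma> ^ (q - 1))) (z \<omega>)
          = \<gamma> - \<gamma> * t powr (1 / (real q - 1))"
        unfolding profile_def le t using False by (simp add: max_def right_diff_distrib)
      moreover have "\<eta> * z \<omega> \<le> l + real q * \<gamma> ^ (q - 1)" using t1 True by simp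
      then have "X_opt z q \<gamma> B l \<eta> \<omega> = \<gamma> - \<gamma> * t powr (1 / (real q - 1))"
        unfolding X_opt_def * using False by simp
      ultimately show ?thesis by simp
    next
      case t1': False
      then have "1 \<le> t powr (1 / (real q - 1))" using assms(1) by (intro ge_one_powr_ge_zero) auto
      moreover have "\<not> \<eta> * z \<omega> \<le> l + real q * \<gamma> ^ (q - 1)" using t1 t1' by simp
      ultimately show ?thesis
        unfolding X_opt_def profile_def le t using False by simp
    qed
  qed
qed


section \<open>Optimality of the payoffs\<close>

locale goal_problem = capped_problem M z B \<gamma> p x\<^sub>0
  for M :: "'a measure" and z B \<gamma> p x\<^sub>0 +
  fixes G :: "'a measure" and q :: nat and d :: real
  assumes subalg: "subalgebra M G" and z_measurable_G: "z \<in> borel_measurable G"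
    and q_gt_1: "1 < q" and p_eq: "p = 1 / (real q - 1)"
begin

lemma L2_measurable: "X \<in> L2 M G \<Longrightarrow> X \<in> borel_measurable M"
  using measurable_from_subalg[OF subalg] by (auto simp: L2_def)

lemma L2_I:
  assumes "X \<in> borel_measurable G" "AE \<omega> in M. 0 \<le> X \<omega> \<and> X \<omega> \<le> B"
  shows "X \<in> L2 M G"
proof -
  have [measurable]: "X \<in> borel_measurable M" using measurable_from_subalg[OF subalg] assms(1) .
  have "AE \<omega> in M. norm ((X \<omega>)\<^sup>2) \<le> B\<^sup>2"
    using assms(2) by eventually_elim (simp add: power_mono)
  then have "integrable M (\<lambda>\<omega>. (X \<omega>)\<^sup>2)" by (intro integrable_const_bound) auto
  then show ?thesis using assms(1) by (simp add: L2_def)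
qed

lemma feasible_integrable:
  assumes "Y \<in> feasible M G z x\<^sub>0 d B"
  shows "integrable M Y" "integrable M (\<lambda>\<omega>. z \<omega> * Y \<omega>)"
    "integrable M (\<lambda>\<omega>. pos_part (\<gamma> - Y \<omega>) ^ q)"
proof -
  have Y: "AE \<omega> in M. 0 \<le> Y \<omega> \<and> Y \<omega> \<le> B" using assms by (simp add: feasible_def)
  then have b: "AE \<omega> in M. \<bar>Y \<omega>\<bar> \<le> B" by eventually_elim simp
  have [measurable]: "Y \<in> borel_measurable M"
    using assms L2_measurable by (simp add: feasible_def)
  show "integrable M (\<lambda>\<omega>. z \<omega> * Y \<omega>)" using integrable_weighted[OF z_integrable _ b] by simp
  show "integrable M Y" using integrable_weighted[of "\<lambda>_. 1", OF _ _ b] by simp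
  have "AE \<omega> in M. norm (pos_part (\<gamma> - Y \<omega>) ^ q) \<le> \<gamma> ^ q"
    using Y by eventually_elim (simp add: pos_part_eq power_mono gamma_nonneg)
  then show "integrable M (\<lambda>\<omega>. pos_part (\<gamma> - Y \<omega>) ^ q)"
    by (intro integrable_const_bound) (auto simp: pos_part_eq)
qed

text \<open>Lagrangian duality with \<open>\<eta>\<close> for the budget and \<open>l\<close> for
  the mean. The second assumption on the mean is complementary slackness; strictness of the
  pointwise minimum gives uniqueness.\<close>

lemma the_solution_X_opt:
  assumes "0 < \<gamma>" "0 \<le> l" "0 < \<eta>"
  defines "X \<equiv> X_opt z q \<gamma> B l \<eta>"
  assumes mean: "d \<le> (LINT \<omega>|M. X \<omega>)" "0 < l \<longrightarrow> (LINT \<omega>|M. X \<omega>) = d"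
    and cost: "(LINT \<omega>|M. z \<omega> * X \<omega>) = x\<^sub>0"
  shows "the_solution M G z q \<gamma> x\<^sub>0 d B X"
proof -
  define a where "a = l / \<eta>"
  define s where "s = \<eta> / (real q * \<gamma> ^ (q - 1))"
  have X: "X \<omega> = profile B \<gamma> p a s (z \<omega>)" for \<omega>
    unfolding X_def using X_opt_eq_profile q_gt_1 assms(1,3) by (simp add: p_eq a_def s_def)
  have X_range: "0 \<le> X \<omega>" "X \<omega> \<le> B" for \<omega>
    using profile_nonneg profile_le gamma_nonneg gamma_less by (simp_all add: X)
  have "(\<lambda>\<omega>. profile B \<gamma> p a s (z \<omega>)) \<in> borel_measurable G"
    using z_measurable_G by measurable
  then have X_G: "X \<in> borel_measurable G" by (simp add: X[abs_def])
  have X_feasible: "X \<in> feasible M G z x\<^sub>0 d B"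
    using X_G X_range mean(1) cost by (auto simp: feasible_def intro: L2_I)
  define L where "L Y \<omega> = pos_part (\<gamma> - Y \<omega>) ^ q + (\<eta> * (z \<omega> * Y \<omega>) - l * Y \<omega>)" for Y \<omega>
  have L_integrable: "integrable M (L Y)"
    and L_eq: "(LINT \<omega>|M. L Y \<omega>) = objective M q \<gamma> Y + (\<eta> * x\<^sub>0 - l * (LINT \<omega>|M. Y \<omega>))"
    if "Y \<in> feasible M G z x\<^sub>0 d B" for Y
    using feasible_integrable[OF that] that unfolding L_def
    by (simp_all add: objective_def feasible_def)
  have L_less: "AE \<omega> in M. Y \<omega> = X \<omega> \<or> L X \<omega> < L Y \<omega>" if "Y \<in> feasible M G z x\<^sub>0 d B" for Y
  proof -
    have "AE \<omega> in M. 0 \<le> Y \<omega> \<and> Y \<omega> \<le> B" using that by (simp add: feasible_def)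
    then show ?thesis using z_atomless[of a]
    proof eventually_elim
      case (elim \<omega>)
      define w where "w = \<eta> * z \<omega> - l"
      have "w \<noteq> 0" using elim assms(3) by (simp add: w_def a_def field_simps)
      have "s * (z \<omega> - a) = w / (real q * \<gamma> ^ (q - 1))"
        using assms(3) by (simp add: s_def a_def w_def right_diff_distrib diff_divide_distrib)
      moreover have "z \<omega> \<le> a \<longleftrightarrow> w < 0"
        using elim assms(3) \<open>w \<noteq> 0\<close> by (auto simp: w_def a_def field_simps)
      ultimately have X_eq: "X \<omega> = (if w < 0 then B
          else \<gamma> * max 0 (1 - (w / (real q * \<gamma> ^ (q - 1))) powr (1 / (real q - 1))))"
        unfolding X profile_def p_eq by simp
      have "pos_part (\<gamma> - X \<omega>) ^ q + w * X \<omega> < pos_part (\<gamma> - Y \<omega>) ^ q + w * Y \<omega>" if "Y \<omega> \<noteq> X \<omega>"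
        using lagrangian_less[OF q_gt_1 assms(1) gamma_less \<open>w \<noteq> 0\<close>, of "Y \<omega>", folded X_eq] elim that
        by simp
      then show ?case by (auto simp: L_def w_def algebra_simps)
    qed
  qed
  have objective_le: "objective M q \<gamma> X \<le> objective M q \<gamma> Y"
    and AE_eq: "objective M q \<gamma> Y \<le> objective M q \<gamma> X \<Longrightarrow> AE \<omega> in M. Y \<omega> = X \<omega>"
    if Y: "Y \<in> feasible M G z x\<^sub>0 d B" for Y
  proof -
    have le: "AE \<omega> in M. L X \<omega> \<le> L Y \<omega>"
      using L_less[OF Y] by eventually_elim (auto simp: L_def)
    \<comment> \<open>For positive \<open>l\<close> slackness gives mean \<open>d\<close>, the least
      that a feasible \<open>Y\<close> can have; hence the multiplier term never favours
      \<open>Y\<close>.\<close>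
    have "l * (LINT \<omega>|M. X \<omega>) \<le> l * (LINT \<omega>|M. Y \<omega>)"
      using mean assms(2) Y by (cases "l = 0") (auto simp: feasible_def)
    then have diff: "(LINT \<omega>|M. L Y \<omega>) - (LINT \<omega>|M. L X \<omega>) \<le> objective M q \<gamma> Y - objective M q \<gamma> X"
      using L_eq[OF Y] L_eq[OF X_feasible] by simp
    moreover have L_mono: "(LINT \<omega>|M. L X \<omega>) \<le> (LINT \<omega>|M. L Y \<omega>)"
      using le L_integrable Y X_feasible by (intro integral_mono_AE) auto
    ultimately show "objective M q \<gamma> X \<le> objective M q \<gamma> Y" by simp
    assume "objective M q \<gamma> Y \<le> objective M q \<gamma> X"
    \<comment> \<open>An equally good \<open>Y\<close> has the same integrated Lagrangian, so the
      pointwise inequality is an equality almost surely.\<close>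
    then have "(LINT \<omega>|M. L Y \<omega> - L X \<omega>) = 0"
      using diff L_mono L_integrable Y X_feasible by simp
    moreover have "AE \<omega> in M. 0 \<le> L Y \<omega> - L X \<omega>" using le by eventually_elim simp
    ultimately have "AE \<omega> in M. L Y \<omega> - L X \<omega> = 0"
      using L_integrable Y X_feasible by (subst (asm) integral_nonneg_eq_0_iff_AE) auto
    then show "AE \<omega> in M. Y \<omega> = X \<omega>" using L_less[OF Y] by eventually_elim auto
  qed
  show ?thesis
    unfolding the_solution_def solutions_def using X_feasible objective_le AE_eq by auto
qed

section \<open>Payoffs without shortfall\<close>

lemma X_set_eq_zero_objective:
  "X_set M G z \<gamma> x\<^sub>0 d B = {Y \<in> feasible M G z x\<^sub>0 d B. objective M q \<gamma> Y = 0}"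
proof -
  have 0: "objective M q \<gamma> Y = 0 \<longleftrightarrow> (AE \<omega> in M. \<gamma> \<le> Y \<omega>)" if "Y \<in> feasible M G z x\<^sub>0 d B" for Y
    unfolding objective_def using feasible_integrable(3)[OF that] q_gt_1
    by (subst integral_nonneg_eq_0_iff_AE) (auto simp: pos_part_eq max_def)
  show ?thesis
  proof (intro subset_antisym subsetI)
    fix Y assume Y: "Y \<in> X_set M G z \<gamma> x\<^sub>0 d B"
    then have *: "AE \<omega> in M. \<gamma> \<le> Y \<omega> \<and> Y \<omega> \<le> B" by (simp add: X_set_def)
    then have "AE \<omega> in M. 0 \<le> Y \<omega> \<and> Y \<omega> \<le> B"
      by eventually_elim (use gamma_nonneg in simp)
    then have "Y \<in> feasible M G z x\<^sub>0 d B" using Y by (auto simp: X_set_def feasible_def)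
    then show "Y \<in> {Y \<in> feasible M G z x\<^sub>0 d B. objective M q \<gamma> Y = 0}" using 0 * by auto
  next
    fix Y assume "Y \<in> {Y \<in> feasible M G z x\<^sub>0 d B. objective M q \<gamma> Y = 0}"
    then have "Y \<in> feasible M G z x\<^sub>0 d B" "AE \<omega> in M. \<gamma> \<le> Y \<omega>" using 0 by auto
    then show "Y \<in> X_set M G z \<gamma> x\<^sub>0 d B" by (simp add: X_set_def feasible_def)
  qed
qed

text \<open>The objective is nonnegative, so once the value 0 is attained the minimisers are exactly
  its zeros.\<close>

lemma solutions_eq_X_set:
  assumes "X_set M G z \<gamma> x\<^sub>0 d B \<noteq> {}"
  shows "solutions M G z q \<gamma> x\<^sub>0 d B = X_set M G z \<gamma> x\<^sub>0 d B"
proof -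
  have nonneg: "0 \<le> objective M q \<gamma> Y" for Y
    unfolding objective_def by (intro Bochner_Integration.integral_nonneg) (simp add: pos_part_eq)
  obtain Z where Z: "Z \<in> feasible M G z x\<^sub>0 d B" "objective M q \<gamma> Z = 0"
    using assms unfolding X_set_eq_zero_objective by blast
  have "(\<forall>Y\<in>feasible M G z x\<^sub>0 d B. objective M q \<gamma> X \<le> objective M q \<gamma> Y) \<longleftrightarrow> objective M q \<gamma> X = 0" for X
    using Z nonneg by (metis order_antisym)
  then show ?thesis unfolding X_set_eq_zero_objective solutions_def by simp
qed

text \<open>This payoff is the profile of slope 0 at the threshold where \<open>H M z 1\<close>
  equals \<open>excess\<close>.\<close>

lemma x_star:
  assumes "\<gamma> * (LINT \<omega>|M. z \<omega>) \<le> x\<^sub>0"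
  defines "X \<equiv> x_star M z \<gamma> x\<^sub>0 B"
  shows "X \<in> borel_measurable G" "X \<omega> = \<gamma> \<or> X \<omega> = B"
    "(LINT \<omega>|M. X \<omega>) = d_lower M z p x\<^sub>0 \<gamma> B" "(LINT \<omega>|M. z \<omega> * X \<omega>) = x\<^sub>0"
proof -
  define y where "y = H1_inv M z excess"
  note y = d_lower_H1_inv[OF assms(1), folded y_def]
  have X: "X \<omega> = profile B \<gamma> p y 0 (z \<omega>)" for \<omega>
    by (simp add: X_def x_star_def profile_slope_0 y_def excess_def indicator_def)
  then show "X \<omega> = \<gamma> \<or> X \<omega> = B" by (simp add: profile_def)
  have "(\<lambda>\<omega>. profile B \<gamma> p y 0 (z \<omega>)) \<in> borel_measurable G"
    using z_measurable_G by measurable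
  then show "X \<in> borel_measurable G" by (simp add: X[abs_def])
  show "(LINT \<omega>|M. X \<omega>) = d_lower M z p x\<^sub>0 \<gamma> B" using y by (simp add: X mean_def)
  have "(LINT \<omega>|M. z \<omega> * X \<omega>) = cost y 0" by (simp add: X cost_def)
  also have "\<dots> = x\<^sub>0" using y(2) gamma_less by (simp add: cost_slope_0 excess_def)
  finally show "(LINT \<omega>|M. z \<omega> * X \<omega>) = x\<^sub>0" .
qed

lemma X_setI:
  assumes "X \<in> borel_measurable G" "\<And>\<omega>. \<gamma> \<le> X \<omega>" "\<And>\<omega>. X \<omega> \<le> B"
    and "d \<le> (LINT \<omega>|M. X \<omega>)" "(LINT \<omega>|M. z \<omega> * X \<omega>) = x\<^sub>0"
  shows "X \<in> X_set M G z \<gamma> x\<^sub>0 d B"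
proof -
  have "X \<in> L2 M G" using assms(1,3) order_trans[OF gamma_nonneg assms(2)] by (intro L2_I) simp_all
  then show ?thesis using assms by (simp add: X_set_def)
qed

lemma x_star_in_X_set:
  assumes "\<gamma> * (LINT \<omega>|M. z \<omega>) \<le> x\<^sub>0" "d \<le> d_lower M z p x\<^sub>0 \<gamma> B"
  shows "x_star M z \<gamma> x\<^sub>0 B \<in> X_set M G z \<gamma> x\<^sub>0 d B"
proof (rule X_setI)
  show "\<gamma> \<le> x_star M z \<gamma> x\<^sub>0 B \<omega>" "x_star M z \<gamma> x\<^sub>0 B \<omega> \<le> B" for \<omega>
    using x_star(2)[OF assms(1), of \<omega>] gamma_less by auto
qed (use x_star[OF assms(1)] assms(2) in simp_all)

text \<open>The second solution is a convex combination of \<open>x_star\<close> with the constant payoff of the same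
  price, whose value lies strictly between \<open>\<gamma>\<close> and \<open>B\<close>.\<close>

lemma X_set_not_unique:
  assumes less: "\<gamma> * (LINT \<omega>|M. z \<omega>) < x\<^sub>0" "d < d_lower M z p x\<^sub>0 \<gamma> B"
  obtains Y where "Y \<in> X_set M G z \<gamma> x\<^sub>0 d B" "\<not> (AE \<omega> in M. x_star M z \<gamma> x\<^sub>0 B \<omega> = Y \<omega>)"
proof -
  define X where "X = x_star M z \<gamma> x\<^sub>0 B"
  note X = x_star[OF less_imp_le[OF less(1)], folded X_def]
  have [measurable]: "X \<in> borel_measurable M" using measurable_from_subalg[OF subalg X(1)] .
  have X_bounds: "\<gamma> \<le> X \<omega>" "X \<omega> \<le> B" for \<omega> using X(2)[of \<omega>] gamma_less by auto
  have bound: "AE \<omega> in M. \<bar>X \<omega>\<bar> \<le> B"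
    using X_bounds order_trans[OF gamma_nonneg X_bounds(1)] by simp
  have int: "integrable M X" "integrable M (\<lambda>\<omega>. z \<omega> * X \<omega>)"
    using integrable_weighted[of "\<lambda>_. 1", OF _ _ bound] integrable_weighted[OF z_integrable _ bound] by simp_all
  have E: "0 < (LINT \<omega>|M. z \<omega>)" 
  proof -
    have "0 < B * (LINT \<omega>|M. z \<omega>)" using x0_pos x0_less by (rule less_trans)
    then show ?thesis using B_pos by (simp add: zero_less_mult_iff)
  qed
  define c where "c = x\<^sub>0 / (LINT \<omega>|M. z \<omega>)"
  have c: "\<gamma> < c" "c < B" using less(1) x0_less E by (auto simp: c_def field_simps)
  define D where "D = d_lower M z p x\<^sub>0 \<gamma> B"
  \<comment> \<open>Moving from \<open>X\<close> towards \<open>c\<close> changes the mean by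
    \<open>t * (D - c)\<close>; this \<open>t\<close> keeps the loss within \<open>D - d\<close>,
    and \<open>D - d\<close> in the denominator keeps \<open>t\<close> in the interval from 0 to 1
    and nonzero.\<close>
  define t where "t = (D - d) / (D - d + \<bar>D - c\<bar>)"
  have Dd: "0 < D - d" using less(2) by (simp add: D_def)
  then have t: "0 < t" "t \<le> 1" by (simp_all add: t_def add_pos_nonneg divide_le_eq)
  have "t * (D - d + \<bar>D - c\<bar>) = D - d" using Dd by (simp add: t_def)
  moreover have "0 \<le> t * (D - d)" using t Dd by simp
  ultimately have t_le: "t * \<bar>D - c\<bar> \<le> D - d" unfolding distrib_left by linarith
  define Y where "Y \<omega> = (1 - t) * X \<omega> + t * c" for \<omega>
  show thesis
  proof (rule that)
    show "Y \<in> X_set M G z \<gamma> x\<^sub>0 d B"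
    proof (rule X_setI)
      show "Y \<in> borel_measurable G" unfolding Y_def using X(1) by measurable
      show "\<gamma> \<le> Y \<omega>" "Y \<omega> \<le> B" for \<omega>
        using convex_bound_le[of "X \<omega>" B c "1 - t" t] convex_bound_le[of "- X \<omega>" "- \<gamma>" "- c" "1 - t" t]
          X_bounds[of \<omega>] c t by (auto simp: Y_def)
      have "(LINT \<omega>|M. Y \<omega>) = D - t * (D - c)"
        unfolding Y_def using int X(3) by (simp add: prob_space D_def algebra_simps)
      moreover have "t * (D - c) \<le> t * \<bar>D - c\<bar>" using t by (intro mult_left_mono) auto
      ultimately show "d \<le> (LINT \<omega>|M. Y \<omega>)" using t_le by linarith
      have "(LINT \<omega>|M. z \<omega> * Y \<omega>) = (LINT \<omega>|M. (1 - t) * (z \<omega> * X \<omega>) + t * c * z \<omega>)"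
        by (simp add: Y_def algebra_simps)
      also have "\<dots> = (1 - t) * x\<^sub>0 + t * x\<^sub>0"
        using int z_integrable X(4) E by (simp add: c_def)
      finally show "(LINT \<omega>|M. z \<omega> * Y \<omega>) = x\<^sub>0" by (simp add: algebra_simps)
    qed
    \<comment> \<open>Since \<open>X\<close> takes only the values \<open>\<gamma>\<close> and
      \<open>B\<close>, it never equals \<open>c\<close>, so the two payoffs differ in every
      state.\<close>
    have "Y \<omega> - X \<omega> = t * (c - X \<omega>)" for \<omega> by (simp add: Y_def algebra_simps)
    moreover have "c \<noteq> X \<omega>" for \<omega> using X(2)[of \<omega>] c by auto
    ultimately have "X \<omega> \<noteq> Y \<omega>" for \<omega> using t(1) by (metis diff_self mult_eq_0_iff less_irrefl right_minus_eq)
    then show "\<not> (AE \<omega> in M. x_star M z \<gamma> x\<^sub>0 B \<omega> = Y \<omega>)" using AE_False by (simp flip: X_def)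
  qed
qed


section \<open>Existence and uniqueness of the multipliers\<close>

lemma X_opt_integrals:
  assumes "0 < \<gamma>" "0 < \<eta>"
  shows "(LINT \<omega>|M. X_opt z q \<gamma> B l \<eta> \<omega>) = mean (l / \<eta>) (\<eta> / (real q * \<gamma> ^ (q - 1)))"
    and "(LINT \<omega>|M. z \<omega> * X_opt z q \<gamma> B l \<eta> \<omega>) = cost (l / \<eta>) (\<eta> / (real q * \<gamma> ^ (q - 1)))"
  unfolding X_opt_eq_profile[OF q_gt_1 assms] mean_def cost_def unfolding p_eq by (rule refl)+

text \<open>Existence comes from the budget curve. For uniqueness, two admissible pairs both give
  the optimal payoff, hence payoffs equal almost surely, and \<open>profile_unique\<close> recovers
  the parameters.\<close>

lemma unique_multipliers:
  assumes "d_lower M z p x\<^sub>0 \<gamma> B < d" "d < d_upper M z x\<^sub>0 B"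
  shows "\<exists>!(l, \<eta>). 0 < l \<and> 0 < \<eta> \<and> (LINT \<omega>|M. X_opt z q \<gamma> B l \<eta> \<omega>) = d \<and>
    (LINT \<omega>|M. z \<omega> * X_opt z q \<gamma> B l \<eta> \<omega>) = x\<^sub>0"
proof -
  have g: "0 < \<gamma>" using gamma_pos_if_d_lower_less assms by simp
  define c where "c = real q * \<gamma> ^ (q - 1)"
  have c: "0 < c" using g q_gt_1 by (simp add: c_def)
  note int = X_opt_integrals[OF g, folded c_def]
  obtain a s where as: "0 < a" "0 < s" "mean a s = d" "cost a s = x\<^sub>0"
    using exists_profile[OF assms] .
  show ?thesis
  proof (rule ex1I)
    \<comment> \<open>Inverts the change of coordinates: \<open>\<eta> = s * c\<close> and
      \<open>l = a * \<eta>\<close>.\<close>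
    show "case (a * (s * c), s * c) of (l, \<eta>) \<Rightarrow> 0 < l \<and> 0 < \<eta> \<and>
        (LINT \<omega>|M. X_opt z q \<gamma> B l \<eta> \<omega>) = d \<and> (LINT \<omega>|M. z \<omega> * X_opt z q \<gamma> B l \<eta> \<omega>) = x\<^sub>0"
      using as c by (simp add: int)
    fix l\<eta>
    assume "case l\<eta> of (l, \<eta>) \<Rightarrow> 0 < l \<and> 0 < \<eta> \<and>
        (LINT \<omega>|M. X_opt z q \<gamma> B l \<eta> \<omega>) = d \<and> (LINT \<omega>|M. z \<omega> * X_opt z q \<gamma> B l \<eta> \<omega>) = x\<^sub>0"
    then obtain l \<eta> where l\<eta>: "l\<eta> = (l, \<eta>)" "0 < l" "0 < \<eta>"
      "(LINT \<omega>|M. X_opt z q \<gamma> B l \<eta> \<omega>) = d" "(LINT \<omega>|M. z \<omega> * X_opt z q \<gamma> B l \<eta> \<omega>) = x\<^sub>0"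
      by (cases l\<eta>) auto
    have "the_solution M G z q \<gamma> x\<^sub>0 d B (X_opt z q \<gamma> B l \<eta>)"
      using l\<eta> g by (intro the_solution_X_opt) auto
    moreover have "the_solution M G z q \<gamma> x\<^sub>0 d B (X_opt z q \<gamma> B (a * (s * c)) (s * c))"
      using as c g by (intro the_solution_X_opt) (simp_all add: int)
    ultimately have "AE \<omega> in M. X_opt z q \<gamma> B (a * (s * c)) (s * c) \<omega> = X_opt z q \<gamma> B l \<eta> \<omega>"
      unfolding the_solution_def by blast
    then have "AE \<omega> in M. profile B \<gamma> p a s (z \<omega>) = profile B \<gamma> p (l / \<eta>) (\<eta> / c) (z \<omega>)"
      using X_opt_eq_profile[OF q_gt_1 g, folded c_def p_eq, of "s * c" z B "a * (s * c)"]
        X_opt_eq_profile[OF q_gt_1 g l\<eta>(3), folded c_def p_eq, of z B l] as c by simp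
    then have "a = l / \<eta> \<and> s = \<eta> / c"
      using as c l\<eta> assms(2) by (intro profile_unique[OF g]) auto
    then show "l\<eta> = (a * (s * c), s * c)" using l\<eta> c by simp
  qed
qed

text \<open>With \<open>l = 0\<close> the mean constraint may be slack, and the stated
  \<open>\<eta>\<close> corresponds to the slope
  \<open>1 / K_inv M z p (x\<^sub>0 / \<gamma>)\<close>.\<close>

lemma zero_multiplier:
  assumes "d \<le> d_lower M z p x\<^sub>0 \<gamma> B" "x\<^sub>0 < \<gamma> * (LINT \<omega>|M. z \<omega>)"
  defines "\<eta> \<equiv> real q * \<gamma> ^ (q - 1) / K_inv M z p (x\<^sub>0 / \<gamma>)"
  shows "0 < \<eta>" "d \<le> (LINT \<omega>|M. X_opt z q \<gamma> B 0 \<eta> \<omega>)"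
    "(LINT \<omega>|M. z \<omega> * X_opt z q \<gamma> B 0 \<eta> \<omega>) = x\<^sub>0"
    "the_solution M G z q \<gamma> x\<^sub>0 d B (X_opt z q \<gamma> B 0 \<eta>)"
proof -
  have g: "0 < \<gamma>" using assms(2) x0_pos gamma_nonneg by (cases "\<gamma> = 0") auto
  note K = K_inv[OF assms(2)]
  define c where "c = real q * \<gamma> ^ (q - 1)"
  have c: "0 < c" "\<eta> = c / K_inv M z p (x\<^sub>0 / \<gamma>)" using g q_gt_1 by (simp_all add: c_def \<eta>_def)
  then show \<eta>: "0 < \<eta>" using K by simp
  have "\<eta> / c = 1 / K_inv M z p (x\<^sub>0 / \<gamma>)" using c by simp
  then show mean: "d \<le> (LINT \<omega>|M. X_opt z q \<gamma> B 0 \<eta> \<omega>)"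
    and cost: "(LINT \<omega>|M. z \<omega> * X_opt z q \<gamma> B 0 \<eta> \<omega>) = x\<^sub>0"
    using X_opt_integrals[OF g \<eta>, of 0, folded c_def] K assms(1) by simp_all
  show "the_solution M G z q \<gamma> x\<^sub>0 d B (X_opt z q \<gamma> B 0 \<eta>)"
    using g \<eta> mean cost by (intro the_solution_X_opt) auto
qed

end

section \<open>From the market model to the abstract problem\<close>

lemma borel_measurable_state_price_density:
  fixes F :: "real \<Rightarrow> 'a measure" and \<theta> :: "real \<Rightarrow> 'a \<Rightarrow> real ^ 'n::finite"
  assumes "progressive F T r" "progressive F T \<theta>" "I \<in> borel_measurable (F T)" "0 \<le> T"
  shows "state_price_density r \<theta> T I \<in> borel_measurable (F T)"
proof -
  \<comment> \<open>Progressive measurability gives joint measurability only on the time interval,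
    so Lebesgue measure is restricted to it before integrating out time.\<close>
  define L where "L = restrict_space lborel {0..T}"
  interpret L: sigma_finite_measure L
    unfolding L_def by (intro sigma_finite_measure_restrict_space sigma_finite_lborel) simp
  have "sets (L \<Otimes>\<^sub>M F T) = sets (restrict_space borel {0..T} \<Otimes>\<^sub>M F T)"
    unfolding L_def by (intro sets_pair_measure_cong sets_restrict_space_cong) auto
  note meas = measurable_cong_sets[OF this refl]
  have [measurable]: "(\<lambda>(s, \<omega>). r s \<omega>) \<in> borel_measurable (L \<Otimes>\<^sub>M F T)"
    "(\<lambda>(s, \<omega>). \<theta> s \<omega>) \<in> borel_measurable (L \<Otimes>\<^sub>M F T)"
    using assms by (auto simp: progressive_def meas)
  have "(\<lambda>(s, \<omega>). r s \<omega> + 1/2 * (norm (\<theta> s \<omega>))\<^sup>2) \<in> borel_measurable (L \<Otimes>\<^sub>M F T)"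
    by measurable
  from measurable_pair_swap[OF this]
  have "(\<lambda>(\<omega>, s). r s \<omega> + 1/2 * (norm (\<theta> s \<omega>))\<^sup>2) \<in> borel_measurable (F T \<Otimes>\<^sub>M L)"
    by (simp add: case_prod_beta')
  then have [measurable]: "(\<lambda>\<omega>. LINT s|L. r s \<omega> + 1/2 * (norm (\<theta> s \<omega>))\<^sup>2) \<in> borel_measurable (F T)"
    by (rule L.borel_measurable_lebesgue_integral)
  have "(LINT s:{0..T}|lborel. f s) = (LINT s|L. f s)" for f :: "real \<Rightarrow> real"
    by (simp add: L_def set_lebesgue_integral_def integral_restrict_space)
  then show ?thesis
    unfolding state_price_density_def[abs_def] using assms(3) by simp
qed

text \<open>Multiplicity in the third part is claimed under strict inequalities. If the budget
  equals the price of \<open>\<gamma>\<close>, only the constant \<open>\<gamma>\<close> remains up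
  to null sets; if \<open>d\<close> equals the lower critical value, only \<open>x_star\<close> has
  a large enough mean.\<close>

theorem mainTheorem1:
  fixes M :: "'a measure"
    and F :: "real \<Rightarrow> 'a measure"
    and W :: "real \<Rightarrow> 'a \<Rightarrow> real ^ 'n::finite"
    and r :: "real \<Rightarrow> 'a \<Rightarrow> real"
    and \<mu> :: "'n \<Rightarrow> real \<Rightarrow> 'a \<Rightarrow> real"
    and \<sigma> :: "real \<Rightarrow> 'a \<Rightarrow> real ^ 'n ^ 'n"
    and z I :: "'a \<Rightarrow> real"
    and \<psi> :: "real \<Rightarrow> real"
    and T x\<^sub>0 d \<gamma> B xbar p :: real
    and q :: nat
  assumes market: "market M F T W r \<mu> \<sigma>"
    and ito: "is_ito_integral M F W T (market_price_of_risk r \<mu> \<sigma>) I"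
    and z_def: "z = state_price_density r (market_price_of_risk r \<mu> \<sigma>) T I"
    and z_integrable: "integrable M z"
    and density: "distributed M lborel z (\<lambda>y. ennreal (\<psi> y))" "\<And>y. 0 \<le> \<psi> y"
    and density_continuous: "continuous_on {0<..} \<psi>"
    and q: "1 < q"
    and p_def: "p = 1 / (real q - 1)"
    and gamma: "0 \<le> \<gamma>"
    and B: "max d (max xbar \<gamma>) < B"
    and x0: "0 < x\<^sub>0" "x\<^sub>0 < B * (LINT \<omega>|M. z \<omega>)"
  shows
    "(d_lower M z p x\<^sub>0 \<gamma> B < d \<and> d < d_upper M z x\<^sub>0 B \<longrightarrow>
        (\<exists>!(l, \<eta>). 0 < l \<and> 0 < \<eta> \<and> (LINT \<omega>|M. X_opt z q \<gamma> B l \<eta> \<omega>) = d \<and>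
           (LINT \<omega>|M. z \<omega> * X_opt z q \<gamma> B l \<eta> \<omega>) = x\<^sub>0) \<and>
        (\<forall>l \<eta>. 0 < l \<and> 0 < \<eta> \<and> (LINT \<omega>|M. X_opt z q \<gamma> B l \<eta> \<omega>) = d \<and>
           (LINT \<omega>|M. z \<omega> * X_opt z q \<gamma> B l \<eta> \<omega>) = x\<^sub>0 \<longrightarrow>
           the_solution M (F T) z q \<gamma> x\<^sub>0 d B (X_opt z q \<gamma> B l \<eta>))) \<and>
     (d \<le> d_lower M z p x\<^sub>0 \<gamma> B \<and> x\<^sub>0 < \<gamma> * (LINT \<omega>|M. z \<omega>) \<longrightarrow>
        (let \<eta> = q * \<gamma> ^ (q - 1) / K_inv M z p (x\<^sub>0 / \<gamma>) in
           0 < \<eta> \<and>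
           the_solution M (F T) z q \<gamma> x\<^sub>0 d B (X_opt z q \<gamma> B 0 \<eta>) \<and>
           (LINT \<omega>|M. X_opt z q \<gamma> B 0 \<eta> \<omega>) \<ge> d \<and>
           (LINT \<omega>|M. z \<omega> * X_opt z q \<gamma> B 0 \<eta> \<omega>) = x\<^sub>0)) \<and>
     (d \<le> d_lower M z p x\<^sub>0 \<gamma> B \<and> \<gamma> * (LINT \<omega>|M. z \<omega>) \<le> x\<^sub>0 \<longrightarrow>
        solutions M (F T) z q \<gamma> x\<^sub>0 d B = X_set M (F T) z \<gamma> x\<^sub>0 d B \<and>
        x_star M z \<gamma> x\<^sub>0 B \<in> solutions M (F T) z q \<gamma> x\<^sub>0 d B \<and>
        (d < d_lower M z p x\<^sub>0 \<gamma> B \<and> \<gamma> * (LINT \<omega>|M. z \<omega>) < x\<^sub>0 \<longrightarrow>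
           (\<exists>Y \<in> solutions M (F T) z q \<gamma> x\<^sub>0 d B. \<exists>Y' \<in> solutions M (F T) z q \<gamma> x\<^sub>0 d B.
              \<not> (AE \<omega> in M. Y \<omega> = Y' \<omega>))))"
proof -
  interpret market M F T W r \<mu> \<sigma> by (fact market)
  have z_F: "z \<in> borel_measurable (F T)"
    unfolding z_def using ito rate(1) horizon
    by (intro borel_measurable_state_price_density) (auto simp: is_ito_integral_def)
  \<comment> \<open>A Lebesgue density excludes atoms, since singletons are Lebesgue null.\<close>
  have "AE \<omega> in M. z \<omega> \<noteq> c" for c
    using AE_lborel_singleton[of c] by (subst distributed_AE2[OF density(1)]) auto
  moreover have "0 < z \<omega>" for \<omega> by (simp add: z_def state_price_density_def)
  ultimately interpret goal_problem M z B \<gamma> p x\<^sub>0 "F T" q d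
    using z_integrable z_F gamma B x0 q p_def sets_F_le[of T]
    by unfold_locales (auto simp: subalgebra_def space_F)
  have "the_solution M (F T) z q \<gamma> x\<^sub>0 d B (X_opt z q \<gamma> B l \<eta>)"
    if "d_lower M z p x\<^sub>0 \<gamma> B < d \<and> d < d_upper M z x\<^sub>0 B"
      "0 < l \<and> 0 < \<eta> \<and> (LINT \<omega>|M. X_opt z q \<gamma> B l \<eta> \<omega>) = d \<and>
        (LINT \<omega>|M. z \<omega> * X_opt z q \<gamma> B l \<eta> \<omega>) = x\<^sub>0" for l \<eta>
    using that gamma_pos_if_d_lower_less by (intro the_solution_X_opt) auto
  then have i: "d_lower M z p x\<^sub>0 \<gamma> B < d \<and> d < d_upper M z x\<^sub>0 B \<longrightarrow>
      (\<exists>!(l, \<eta>). 0 < l \<and> 0 < \<eta> \<and> (LINT \<omega>|M. X_opt z q \<gamma> B l \<eta> \<omega>) = d \<and>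
         (LINT \<omega>|M. z \<omega> * X_opt z q \<gamma> B l \<eta> \<omega>) = x\<^sub>0) \<and>
      (\<forall>l \<eta>. 0 < l \<and> 0 < \<eta> \<and> (LINT \<omega>|M. X_opt z q \<gamma> B l \<eta> \<omega>) = d \<and>
         (LINT \<omega>|M. z \<omega> * X_opt z q \<gamma> B l \<eta> \<omega>) = x\<^sub>0 \<longrightarrow>
         the_solution M (F T) z q \<gamma> x\<^sub>0 d B (X_opt z q \<gamma> B l \<eta>))"
    using unique_multipliers by simp
  have ii: "d \<le> d_lower M z p x\<^sub>0 \<gamma> B \<and> x\<^sub>0 < \<gamma> * (LINT \<omega>|M. z \<omega>) \<longrightarrow>
      (let \<eta> = q * \<gamma> ^ (q - 1) / K_inv M z p (x\<^sub>0 / \<gamma>) in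
         0 < \<eta> \<and>
         the_solution M (F T) z q \<gamma> x\<^sub>0 d B (X_opt z q \<gamma> B 0 \<eta>) \<and>
         (LINT \<omega>|M. X_opt z q \<gamma> B 0 \<eta> \<omega>) \<ge> d \<and>
         (LINT \<omega>|M. z \<omega> * X_opt z q \<gamma> B 0 \<eta> \<omega>) = x\<^sub>0)"
    unfolding Let_def using zero_multiplier by simp
  have iii: "d \<le> d_lower M z p x\<^sub>0 \<gamma> B \<and> \<gamma> * (LINT \<omega>|M. z \<omega>) \<le> x\<^sub>0 \<longrightarrow>
      solutions M (F T) z q \<gamma> x\<^sub>0 d B = X_set M (F T) z \<gamma> x\<^sub>0 d B \<and>
      x_star M z \<gamma> x\<^sub>0 B \<in> solutions M (F T) z q \<gamma> x\<^sub>0 d B \<and>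
      (d < d_lower M z p x\<^sub>0 \<gamma> B \<and> \<gamma> * (LINT \<omega>|M. z \<omega>) < x\<^sub>0 \<longrightarrow>
         (\<exists>Y \<in> solutions M (F T) z q \<gamma> x\<^sub>0 d B. \<exists>Y' \<in> solutions M (F T) z q \<gamma> x\<^sub>0 d B.
            \<not> (AE \<omega> in M. Y \<omega> = Y' \<omega>)))"
  proof (intro impI)
    assume case_iii: "d \<le> d_lower M z p x\<^sub>0 \<gamma> B \<and> \<gamma> * (LINT \<omega>|M. z \<omega>) \<le> x\<^sub>0"
    have star: "x_star M z \<gamma> x\<^sub>0 B \<in> X_set M (F T) z \<gamma> x\<^sub>0 d B"
      using case_iii x_star_in_X_set by simp
    moreover have eq: "solutions M (F T) z q \<gamma> x\<^sub>0 d B = X_set M (F T) z \<gamma> x\<^sub>0 d B"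
      using star by (intro solutions_eq_X_set) auto
    moreover have "\<exists>Y \<in> X_set M (F T) z \<gamma> x\<^sub>0 d B. \<exists>Y' \<in> X_set M (F T) z \<gamma> x\<^sub>0 d B.
        \<not> (AE \<omega> in M. Y \<omega> = Y' \<omega>)"
      if less: "d < d_lower M z p x\<^sub>0 \<gamma> B \<and> \<gamma> * (LINT \<omega>|M. z \<omega>) < x\<^sub>0"
    proof -
      obtain Y where "Y \<in> X_set M (F T) z \<gamma> x\<^sub>0 d B" "\<not> (AE \<omega> in M. x_star M z \<gamma> x\<^sub>0 B \<omega> = Y \<omega>)"
        using X_set_not_unique less by blast
      then show ?thesis using star by blast
    qed
    ultimately show "solutions M (F T) z q \<gamma> x\<^sub>0 d B = X_set M (F T) z \<gamma> x\<^sub>0 d B \<and>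
      x_star M z \<gamma> x\<^sub>0 B \<in> solutions M (F T) z q \<gamma> x\<^sub>0 d B \<and>
      (d < d_lower M z p x\<^sub>0 \<gamma> B \<and> \<gamma> * (LINT \<omega>|M. z \<omega>) < x\<^sub>0 \<longrightarrow>
         (\<exists>Y \<in> solutions M (F T) z q \<gamma> x\<^sub>0 d B. \<exists>Y' \<in> solutions M (F T) z q \<gamma> x\<^sub>0 d B.
            \<not> (AE \<omega> in M. Y \<omega> = Y' \<omega>)))"
      unfolding eq by simp
  qed
  show ?thesis
    by (rule conjI[OF i conjI[OF ii iii]])
qed

end
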